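(* Let $X$ be a Banach space. Consider $p\in(1,\infty)$, $\alpha\in(0,1/p)$ and assume that $I=[t_0,t_1]$ or $I=[t_0,\infty)$. If $f\in L^p(I;X)$, then $J_{t_0,t}^\alpha f(t)$ is Bochner integrable in $I$ and belongs to $L^{p/(1-p\alpha)}(I;X)$. Moreover, there exists $C_{\alpha,p}>0$ such that $$\left[\int_{I}\left\|J^\alpha_{t_0,s}f(s)\right\|_X^{p/(1-p\alpha)}\,ds\right]^{(1-p\alpha)/p}\leq C_{\alpha,p}\left[\int_{I}\|f(s)\|_X^p\,ds\right]^{1/p}.$$ In other words, $J_{t_0,t}^\alpha$ defines a bounded operator from $L^p(I;X)$ into $L^{p/(1-p\alpha)}(I;X)$.
   Context: For $1\le p<\infty$, $L^p(I;X)$ is the Bochner-Lebesgue space of (classes of) Bochner measurable functions $f:I\to X$ with $\|f\|_X\in L^p(I;\mathbb{R})$, normed by $\|f\|_{L^p(I;X)}=\big[\int_I\|f(s)\|_X^p\,ds\big]^{1/p}$. The Riemann-Liouville fractional integral of order $\alpha>0$ at $t_0$ of $f:I\to X$ is $$J_{t_0,t}^\alpha f(t)=\frac{1}{\Gamma(\alpha)}\int_{t_0}^t (t-s)^{\alpha-1}f(s)\,ds,$$ for every $t\in I$ such that the integral exists; $\Gamma$ is Euler's gamma function. The constant $C_{\alpha,p}$ does not depend on the length of $I$.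
   Formalization: For I=[t_0,∞), "J^α f is Bochner integrable in I" is false (f the indicator of [t_0,t_0+1] times a nonzero vector decays like t^{α-1}); it is read as: the integral defining J^α f(t) exists for a.e. t in I, and J^α f is Bochner integrable on every [t_0,T] contained in I. *)

theory Defs
  imports "HOL-Analysis.Analysis"
begin

text \<open>
  The library's Bochner integral requires the codomain to be second countable, hence separable.
  The notions below are for functions into an arbitrary Banach space.
\<close>

definition Bochner_measurable :: "'a measure \<Rightarrow> ('a \<Rightarrow> 'b::real_normed_vector) \<Rightarrow> bool" where
  "Bochner_measurable M f \<longleftrightarrow>
     (\<exists>s. (\<forall>i::nat. Bochner_Integration.simple_bochner_integrable M (s i)) \<and>
          (AE x in M. (\<lambda>i. s i x) \<longlonglongrightarrow> f x))"

definition has_Bochner_integral ::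
    "'a measure \<Rightarrow> ('a \<Rightarrow> 'b::real_normed_vector) \<Rightarrow> 'b \<Rightarrow> bool" where
  "has_Bochner_integral M f y \<longleftrightarrow>
     Bochner_measurable M f \<and>
     (\<exists>s. (\<forall>i::nat. Bochner_Integration.simple_bochner_integrable M (s i)) \<and>
          (\<lambda>i. \<integral>\<^sup>+x. ennreal (norm (f x - s i x)) \<partial>M) \<longlonglongrightarrow> 0 \<and>
          (\<lambda>i. Bochner_Integration.simple_bochner_integral M (s i)) \<longlonglongrightarrow> y)"

lemma has_Bochner_integral_unique:
  assumes "has_Bochner_integral M f y" and "has_Bochner_integral M f z"
  shows "y = z"
proof -
  from assms obtain u s t
    where u: "\<And>i::nat. Bochner_Integration.simple_bochner_integrable M (u i)"
      and uf: "AE x in M. (\<lambda>i. u i x) \<longlonglongrightarrow> f x"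
      and s: "\<And>i::nat. Bochner_Integration.simple_bochner_integrable M (s i)"
      and sf: "(\<lambda>i. \<integral>\<^sup>+x. ennreal (norm (f x - s i x)) \<partial>M) \<longlonglongrightarrow> 0"
      and sy: "(\<lambda>i. Bochner_Integration.simple_bochner_integral M (s i)) \<longlonglongrightarrow> y"
      and t: "\<And>i::nat. Bochner_Integration.simple_bochner_integrable M (t i)"
      and tf: "(\<lambda>i. \<integral>\<^sup>+x. ennreal (norm (f x - t i x)) \<partial>M) \<longlonglongrightarrow> 0"
      and tz: "(\<lambda>i. Bochner_Integration.simple_bochner_integral M (t i)) \<longlonglongrightarrow> z"
    unfolding has_Bochner_integral_def Bochner_measurable_def by blast
  let ?S = "\<lambda>i. \<integral>\<^sup>+x. ennreal (norm (f x - s i x)) \<partial>M"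
  let ?T = "\<lambda>i. \<integral>\<^sup>+x. ennreal (norm (f x - t i x)) \<partial>M"
  define h where "h v x = liminf (\<lambda>j. ennreal (norm (u j x - v x)))" for v x
  have h_meas: "h v \<in> borel_measurable M"
    if v: "Bochner_Integration.simple_bochner_integrable M v" for v
  proof -
    have "(\<lambda>x. norm (u j x - v x)) \<in> borel_measurable M" for j
    proof -
      have "Bochner_Integration.simple_bochner_integrable M (\<lambda>x. norm (u j x - v x))"
        by (rule simple_bochner_integrable_compose2[OF _ u v]) simp
      then show ?thesis
        by (auto intro: borel_measurable_simple_function
            elim: Bochner_Integration.simple_bochner_integrable.cases)
    qed
    then show ?thesis unfolding h_def by measurable
  qed
  have h_eq: "AE x in M. h v x = ennreal (norm (f x - v x))" for v
    using uf
  proof eventually_elim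
    case (elim x)
    have "(\<lambda>j. ennreal (norm (u j x - v x))) \<longlonglongrightarrow> ennreal (norm (f x - v x))"
      using elim by (intro tendsto_intros)
    then show ?case unfolding h_def by (rule lim_imp_Liminf[OF sequentially_bot])
  qed
  have bound: "ennreal (norm (Bochner_Integration.simple_bochner_integral M (s i)
      - Bochner_Integration.simple_bochner_integral M (t i))) \<le> ?S i + ?T i" (is "?l \<le> _") for i
  proof -
    have "?l = norm (Bochner_Integration.simple_bochner_integral M (\<lambda>x. s i x - t i x))"
      using s t by (subst simple_bochner_integral_diff) auto
    also have "\<dots> \<le> Bochner_Integration.simple_bochner_integral M (\<lambda>x. norm (s i x - t i x))"
      using simple_bochner_integrable_compose2[of "(-)" M "s i" "t i"] s t
      by (auto intro!: simple_bochner_integral_norm_bound)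
    also have "\<dots> = (\<integral>\<^sup>+x. norm (s i x - t i x) \<partial>M)"
      using simple_bochner_integrable_compose2[of "\<lambda>x y. norm (x - y)" M "s i" "t i"] s t
      by (auto intro!: simple_bochner_integral_eq_nn_integral)
    also have "\<dots> \<le> (\<integral>\<^sup>+x. h (s i) x + h (t i) x \<partial>M)"
    proof (rule nn_integral_mono_AE)
      show "AE x in M. ennreal (norm (s i x - t i x)) \<le> h (s i) x + h (t i) x"
        using h_eq[of "s i"] h_eq[of "t i"]
      proof eventually_elim
        case (elim x)
        have "norm (s i x - t i x) \<le> norm (f x - s i x) + norm (f x - t i x)"
          by (metis dual_order.refl norm_diff_triangle_le norm_minus_commute)
        then show ?case unfolding elim
          by (metis ennreal_leI ennreal_plus norm_ge_zero)
      qed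
    qed
    also have "\<dots> = (\<integral>\<^sup>+x. h (s i) x \<partial>M) + (\<integral>\<^sup>+x. h (t i) x \<partial>M)"
      by (rule nn_integral_add[OF h_meas[OF s] h_meas[OF t]])
    also have "\<dots> = ?S i + ?T i"
      using nn_integral_cong_AE[OF h_eq[of "s i"]] nn_integral_cong_AE[OF h_eq[of "t i"]] by (simp only:)
    finally show ?thesis .
  qed
  let ?d = "\<lambda>i. Bochner_Integration.simple_bochner_integral M (s i)
      - Bochner_Integration.simple_bochner_integral M (t i)"
  have "(\<lambda>i. ennreal (norm (?d i))) \<longlonglongrightarrow> ennreal 0"
  proof (rule tendsto_sandwich)
    show "\<forall>\<^sub>F i in sequentially. 0 \<le> ennreal (norm (?d i))" "(\<lambda>_. 0) \<longlonglongrightarrow> ennreal 0"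
      by auto
    show "(\<lambda>i. ?S i + ?T i) \<longlonglongrightarrow> ennreal 0"
      using tendsto_add[OF sf tf] by simp
    show "\<forall>\<^sub>F i in sequentially. ennreal (norm (?d i)) \<le> ?S i + ?T i"
      by (intro always_eventually allI bound)
  qed
  then have "(\<lambda>i. norm (?d i)) \<longlonglongrightarrow> 0"
    by (simp flip: ennreal_0)
  moreover have "(\<lambda>i. norm (?d i)) \<longlonglongrightarrow> norm (y - z)"
    using sy tz by (intro tendsto_intros)
  ultimately have "norm (y - z) = 0"
    by (rule LIMSEQ_unique[symmetric])
  then show ?thesis by simp
qed

definition Bochner_integrable :: "'a measure \<Rightarrow> ('a \<Rightarrow> 'b::real_normed_vector) \<Rightarrow> bool" where
  "Bochner_integrable M f \<longleftrightarrow> (\<exists>y. has_Bochner_integral M f y)"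

text \<open>The value 0 for functions that are not Bochner integrable is a convention.\<close>

definition Bochner_integral ::
    "'a measure \<Rightarrow> ('a \<Rightarrow> 'b::real_normed_vector) \<Rightarrow> 'b" where
  "Bochner_integral M f =
     (if Bochner_integrable M f then THE y. has_Bochner_integral M f y else 0)"

lemma Bochner_integral_eqI: "has_Bochner_integral M f y \<Longrightarrow> Bochner_integral M f = y"
  unfolding Bochner_integral_def Bochner_integrable_def
  by (metis has_Bochner_integral_unique the_equality)

lemma has_bochner_integral_imp_has_Bochner_integral:
  fixes f :: "'a \<Rightarrow> 'b::{banach, second_countable_topology}"
  assumes "has_bochner_integral M f y"
  shows "has_Bochner_integral M f y"
proof -
  have f: "integrable M f" using assms by (rule integrable.intros)
  obtain u where u: "\<And>i. simple_function M (u i)"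
      "\<And>i. emeasure M {y \<in> space M. u i y \<noteq> 0} \<noteq> \<infinity>"
      "\<And>x. x \<in> space M \<Longrightarrow> (\<lambda>i. u i x) \<longlonglongrightarrow> f x"
    by (rule integrable_implies_simple_function_sequence[OF f]) (rule that)
  then have "Bochner_measurable M f"
    unfolding Bochner_measurable_def
    by (intro exI[of _ u]) (simp add: Bochner_Integration.simple_bochner_integrable.simps)
  with assms show ?thesis
    unfolding has_Bochner_integral_def has_bochner_integral.simps by blast
qed

text \<open>
  Elements of \<open>Lp M p\<close> are functions, not classes. The measures used are complete, so that
  a Bochner measurable \<open>f\<close> always has a measurable norm.
\<close>

definition Lp :: "'a measure \<Rightarrow> real \<Rightarrow> ('a \<Rightarrow> 'b::real_normed_vector) set" where
  "Lp M p = {f. Bochner_measurable M f \<and> integrable M (\<lambda>x. norm (f x) powr p)}"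

definition Lp_norm :: "'a measure \<Rightarrow> real \<Rightarrow> ('a \<Rightarrow> 'b::real_normed_vector) \<Rightarrow> real" where
  "Lp_norm M p f = (LINT x|M. norm (f x) powr p) powr (1 / p)"

text \<open>
  A map on functions that induces a bounded linear operator between the spaces of classes
  modulo equality almost everywhere.
\<close>

definition Lp_bounded_operator ::
    "'a measure \<Rightarrow> real \<Rightarrow> real \<Rightarrow> (('a \<Rightarrow> 'b::real_normed_vector) \<Rightarrow> ('a \<Rightarrow> 'b)) \<Rightarrow> bool" where
  "Lp_bounded_operator M p q T \<longleftrightarrow>
     (\<forall>f\<in>Lp M p. T f \<in> Lp M q) \<and>
     (\<forall>f\<in>Lp M p. \<forall>g\<in>Lp M p. (AE x in M. f x = g x) \<longrightarrow> (AE x in M. T f x = T g x)) \<and>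
     (\<forall>f\<in>Lp M p. \<forall>g\<in>Lp M p. AE x in M. T (\<lambda>y. f y + g y) x = T f x + T g x) \<and>
     (\<forall>c. \<forall>f\<in>Lp M p. AE x in M. T (\<lambda>y. c *\<^sub>R f y) x = c *\<^sub>R T f x) \<and>
     (\<exists>C. \<forall>f\<in>Lp M p. Lp_norm M q (T f) \<le> C * Lp_norm M p f)"

definition RL_integrand ::
    "real \<Rightarrow> real \<Rightarrow> (real \<Rightarrow> 'b::real_normed_vector) \<Rightarrow> real \<Rightarrow> 'b" where
  "RL_integrand \<alpha> t f s = ((t - s) powr (\<alpha> - 1)) *\<^sub>R f s"

definition RL_exists_at ::
    "real \<Rightarrow> real \<Rightarrow> (real \<Rightarrow> 'b::real_normed_vector) \<Rightarrow> real \<Rightarrow> bool" where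
  "RL_exists_at \<alpha> t0 f t \<longleftrightarrow> Bochner_integrable (lebesgue_on {t0..t}) (RL_integrand \<alpha> t f)"

definition RL_integral ::
    "real \<Rightarrow> real \<Rightarrow> (real \<Rightarrow> 'b::real_normed_vector) \<Rightarrow> real \<Rightarrow> 'b" where
  "RL_integral \<alpha> t0 f t =
     (1 / Gamma \<alpha>) *\<^sub>R Bochner_integral (lebesgue_on {t0..t}) (RL_integrand \<alpha> t f)"

end

theory Submission
  imports Defs
begin

text \<open>
  Let \<open>G\<close> be the fractional integral of \<open>g = norm f\<close>, where \<open>g\<close> has \<open>L\<^sup>p\<close> norm 1, and let
  \<open>q = p / (1 - p * \<alpha>)\<close>. For each level \<open>l\<close>, cut the kernel at distance \<open>\<delta> = a * l powr (- q)\<close> and \<open>g\<close> at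
  height \<open>h = b * l powr (q / p)\<close>. With suitable \<open>a\<close> and \<open>b\<close>, the far part of the kernel and the part of
  \<open>g\<close> below \<open>h\<close> contribute at most \<open>l / 2\<close> to \<open>G\<close>. Markov's inequality for the remaining part bounds
  the measure of \<open>{G \<ge> l}\<close> by \<open>c * l powr (- (q / p))\<close> times the integral of \<open>g\<close> over \<open>{g > h}\<close>.
  Integrating this against \<open>l powr (q - 1)\<close> and exchanging the integrals yields the bound of \<open>G\<close> in
  \<open>L\<^sup>q\<close> without a maximal function or an interpolation theorem.
  Strong measurability of the fractional integral of \<open>f\<close> is clear for simple functions and passes
  to the limit by the same bound.
\<close>

section \<open>The Hardy-Littlewood-Sobolev inequality for the one-sided kernel\<close>

text \<open>The exponents are forced by scaling: 1/q = 1/p - \<alpha>. Bounding the integral of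
  \<open>g\<close> over \<open>{g > h}\<close> at once by \<open>h powr (1 - p)\<close> would leave
  level sets of size \<open>l powr (- q)\<close>, a weak-type bound whose integral against
  \<open>l powr (q - 1)\<close> diverges logarithmically. That integral is therefore kept until
  after the exchange, where each \<open>s\<close> sees only the levels with \<open>h < g s\<close>.
  The norm of \<open>f\<close> is extended by zero from \<open>I\<close> to the line, so one
  constant serves all intervals. The values lie in an arbitrary Banach space, so exchanges of
  integrals are confined to nonnegative scalar functions; the vector-valued integral enters through
  its norm bound and its linearity. A norm bound says nothing about strong measurability, hence the
  separate density argument. On a half-line, integrability in \<open>I\<close> can only be local:
  the fractional integral of the indicator of \<open>{t0..t0 + 1}\<close> decays like
  \<open>t powr (\<alpha> - 1)\<close>. It is therefore asserted on each \<open>{t0..T}\<close>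
  contained in \<open>I\<close>.\<close>

definition pos_power :: "real \<Rightarrow> real \<Rightarrow> real" where
  "pos_power c u = (if 0 < u then u powr (c - 1) else 0)"

lemma pos_power_nonneg [simp]: "0 \<le> pos_power c u"
  by (simp add: pos_power_def)

lemma pos_power_measurable [measurable]: "pos_power c \<in> borel_measurable borel"
  unfolding pos_power_def by measurable

text \<open>With values in [0, \<infinity>] Tonelli's theorem needs no integrability check, and
  points of divergence stay visible as \<infinity>. The factor 1 / Gamma \<alpha> is left out here
  and restored in \<open>norm_RL_integral_le\<close>.\<close>

definition frac_conv :: "real \<Rightarrow> (real \<Rightarrow> real) \<Rightarrow> real \<Rightarrow> ennreal" where
  "frac_conv \<alpha> g t = (\<integral>\<^sup>+s. ennreal (pos_power \<alpha> (t - s) * g s) \<partial>lborel)"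

lemma frac_conv_measurable [measurable]:
  assumes [measurable]: "g \<in> borel_measurable borel"
  shows "frac_conv \<alpha> g \<in> borel_measurable borel"
  unfolding frac_conv_def by measurable

text \<open>Serves two purposes: with \<open>c = \<alpha>\<close> it is the mass of the truncated
  kernel, with \<open>c = q\<close> or \<open>c = q - q / p\<close> it integrates the weights over
  levels. Since \<open>pos_power\<close> vanishes on the left half-line, both can be written over
  the whole line.\<close>

lemma nn_integral_pos_power:
  assumes "0 < c" "0 \<le> x"
  shows "(\<integral>\<^sup>+u. ennreal (pos_power c u) * indicator {..x} u \<partial>lborel) = ennreal (x powr c / c)"
proof -
  have "((\<lambda>u. u powr (c - 1)) has_integral (x powr c / c)) {0..x}"
    using has_integral_powr_from_0[of "c - 1" x] assms by simp
  then have "(\<integral>\<^sup>+u. ennreal (u powr (c - 1)) * indicator {0..x} u \<partial>lborel) = ennreal (x powr c / c)"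
    by (intro nn_integral_has_integral_lebesgue') auto
  also have "(\<integral>\<^sup>+u. ennreal (u powr (c - 1)) * indicator {0..x} u \<partial>lborel)
      = (\<integral>\<^sup>+u. ennreal (pos_power c u) * indicator {..x} u \<partial>lborel)"
    by (intro nn_integral_cong) (auto simp: pos_power_def indicator_def)
  finally show ?thesis .
qed

lemma nn_integral_powr_tail_le:
  fixes e x :: real
  assumes "e < -1" "0 < x"
  shows "(\<integral>\<^sup>+u. ennreal (u powr e) * indicator {x<..} u \<partial>lborel) \<le> ennreal (x powr (e + 1) / (- (e + 1)))"
proof -
  have "(\<integral>\<^sup>+u. ennreal (u powr e) * indicator {x<..} u \<partial>lborel) \<le> (\<integral>\<^sup>+u. ennreal (u powr e) * indicator {x..} u \<partial>lborel)"
    by (intro nn_integral_mono) (auto simp: indicator_def)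
  also have "\<dots> = ennreal (- (x powr (e + 1)) / (e + 1))"
    using has_integral_powr_to_inf[OF assms] by (intro nn_integral_has_integral_lebesgue') auto
  also have "- (x powr (e + 1)) / (e + 1) = x powr (e + 1) / (- (e + 1))"
    by (metis minus_divide_left minus_divide_right)
  finally show ?thesis .
qed

lemma nn_integral_reflect:
  fixes F :: "real \<Rightarrow> ennreal"
  assumes "F \<in> borel_measurable borel"
  shows "(\<integral>\<^sup>+s. F (t - s) \<partial>lborel) = (\<integral>\<^sup>+u. F u \<partial>lborel)"
  using nn_integral_real_affine[OF assms, of "-1" t] by simp

lemma nn_integral_shift:
  fixes F :: "real \<Rightarrow> ennreal"
  assumes "F \<in> borel_measurable borel"
  shows "(\<integral>\<^sup>+t. F (t - s) \<partial>lborel) = (\<integral>\<^sup>+u. F u \<partial>lborel)"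
  using nn_integral_real_affine[OF assms, of 1 "- s"] by simp

text \<open>Young's inequality for \<open>k / \<theta>\<close> and \<open>g\<close>, multiplied by
  \<theta>. The factors 1 / p' and 1 / p are bounded by 1, since only the dependence on \<theta>
  matters.\<close>

lemma mult_le_scaled_powr:
  fixes k g \<theta> p p' :: real
  assumes "1 < p" "1 < p'" "1 / p' + 1 / p = 1" "0 \<le> k" "0 \<le> g" "0 < \<theta>"
  shows "k * g \<le> \<theta> / \<theta> powr p' * k powr p' + \<theta> * g powr p"
proof -
  have "(k / \<theta>) * g \<le> (k / \<theta>) powr p' / p' + g powr p / p"
    using assms by (intro Youngs_inequality) auto
  also have "\<dots> \<le> (k / \<theta>) powr p' + g powr p"
    using assms by (intro add_mono) (auto simp: divide_le_eq intro!: mult_left_le mult_le_cancel_left1[THEN iffD2])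
  finally have "\<theta> * ((k / \<theta>) * g) \<le> \<theta> * ((k / \<theta>) powr p' + g powr p)"
    using assms by (intro mult_left_mono) auto
  then show ?thesis
    using assms by (simp add: powr_divide algebra_simps)
qed

text \<open>
  The kernel is cut at \<open>\<delta>\<close> and \<open>g\<close> at height \<open>h\<close>. The tail of the kernel is controlled by Young's
  inequality, and \<open>\<theta> = \<delta> powr (\<alpha> - 1 / p)\<close> is the value of its parameter that balances both terms.
\<close>

lemma frac_conv_split:
  fixes p \<alpha> \<delta> h :: real and g :: "real \<Rightarrow> real"
  assumes p: "1 < p" and \<alpha>: "0 < \<alpha>" "\<alpha> < 1 / p" and \<delta>: "0 < \<delta>" and h: "0 \<le> h"
    and g [measurable]: "g \<in> borel_measurable borel" and g0: "\<And>s. 0 \<le> g s"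
    and gp: "(\<integral>\<^sup>+s. ennreal (g s powr p) \<partial>lborel) \<le> 1"
  defines "e \<equiv> (\<alpha> - 1) * (p / (p - 1))"
  shows "frac_conv \<alpha> g t \<le> ennreal (\<delta> powr (\<alpha> - 1 / p) * (1 / (- (e + 1)) + 1)) + ennreal (h * (\<delta> powr \<alpha> / \<alpha>))
    + (\<integral>\<^sup>+s. ennreal (pos_power \<alpha> (t - s)) * indicator {..\<delta>} (t - s) * (ennreal (g s) * indicator {h<..} (g s)) \<partial>lborel)"
proof -
  define p' where "p' = p / (p - 1)"
  define \<theta> where "\<theta> = \<delta> powr (\<alpha> - 1 / p)"
  have p': "1 < p'" "1 / p' + 1 / p = 1"
    using p by (auto simp: p'_def field_simps)
  have \<theta>: "0 < \<theta>" using \<delta> by (simp add: \<theta>_def)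
  \<comment> \<open>\<open>e\<close> is the exponent of the kernel raised to the power
    \<open>p'\<close>. The condition \<alpha> < 1 / p says exactly that this power is integrable at
    infinity.\<close>
  have e: "e < -1"
    using p \<alpha> by (simp add: e_def field_simps)
  \<comment> \<open>The right-hand side is the order of the tail integral of the kernel to the power
    \<open>p'\<close>, so the factor \<open>\<theta> / \<theta> powr p'\<close> in Young's
    inequality reduces that integral to a multiple of \<theta>.\<close>
  have \<theta>p: "\<theta> powr p' = \<delta> powr (e + 1)"
  proof -
    have "(\<alpha> - 1 / p) * p' = e + 1"
      using p by (simp add: e_def p'_def field_simps)
    then show ?thesis by (simp add: \<theta>_def powr_powr)
  qed
  \<comment> \<open>\<open>T1\<close> and \<open>T2\<close> come from Young's inequality on the far
    part, \<open>T3\<close> covers near points with \<open>g s \<le> h\<close>, \<open>T4\<close>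
    near points with \<open>g s > h\<close>. Only \<open>T4\<close> survives as an integral in the
    conclusion.\<close>
  define T1 where "T1 s = ennreal (\<theta> / \<theta> powr p') * (ennreal ((t - s) powr e) * indicator {\<delta><..} (t - s))" for s
  define T2 where "T2 s = ennreal \<theta> * ennreal (g s powr p)" for s
  define T3 where "T3 s = ennreal h * (ennreal (pos_power \<alpha> (t - s)) * indicator {..\<delta>} (t - s))" for s
  define T4 where "T4 s = ennreal (pos_power \<alpha> (t - s)) * indicator {..\<delta>} (t - s) * (ennreal (g s) * indicator {h<..} (g s))" for s
  have [measurable]: "T1 \<in> borel_measurable borel" "T2 \<in> borel_measurable borel"
    "T3 \<in> borel_measurable borel" "T4 \<in> borel_measurable borel"
    unfolding T1_def T2_def T3_def T4_def by measurable
  have pw: "ennreal (pos_power \<alpha> (t - s) * g s) \<le> T1 s + T2 s + T3 s + T4 s" for s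
  proof (cases "t - s \<le> \<delta>")
    case near: True
    show ?thesis
    proof (cases "g s \<le> h")
      case True
      then have "ennreal (pos_power \<alpha> (t - s) * g s) \<le> T3 s"
        using near h g0 by (auto simp: T3_def ennreal_mult[symmetric] mult.commute intro!: ennreal_leI mult_right_mono)
      then show ?thesis by (simp add: add_increasing add_increasing2)
    next
      case False
      then have "ennreal (pos_power \<alpha> (t - s) * g s) \<le> T4 s"
        using near h g0 by (auto simp: T4_def ennreal_mult[symmetric])
      then show ?thesis by (simp add: add_increasing add_increasing2)
    qed
  next
    case False
    then have "pos_power \<alpha> (t - s) powr p' = (t - s) powr e"
      using \<delta> by (simp add: pos_power_def powr_powr e_def p'_def)
    moreover have "ennreal (pos_power \<alpha> (t - s) * g s) \<le> ennreal (\<theta> / \<theta> powr p' * pos_power \<alpha> (t - s) powr p' + \<theta> * g s powr p)"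
      using p p' \<theta> g0 by (intro ennreal_leI mult_le_scaled_powr) auto
    ultimately have "ennreal (pos_power \<alpha> (t - s) * g s) \<le> T1 s + T2 s"
      using False \<theta>
      by (simp add: T1_def T2_def ennreal_mult[symmetric] ennreal_plus[symmetric] del: ennreal_plus)
    then show ?thesis by (simp add: add_increasing2)
  qed
  have i1: "(\<integral>\<^sup>+s. T1 s \<partial>lborel) \<le> ennreal (\<theta> * (1 / (- (e + 1))))"
  proof -
    have "(\<integral>\<^sup>+s. T1 s \<partial>lborel) = ennreal (\<theta> / \<theta> powr p') * (\<integral>\<^sup>+s. ennreal ((t - s) powr e) * indicator {\<delta><..} (t - s) \<partial>lborel)"
      unfolding T1_def by (subst nn_integral_cmult) auto
    also have "\<dots> = ennreal (\<theta> / \<theta> powr p') * (\<integral>\<^sup>+s. ennreal (s powr e) * indicator {\<delta><..} s \<partial>lborel)"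
      by (subst nn_integral_reflect[where F="\<lambda>s. ennreal (s powr e) * indicator {\<delta><..} s"]) auto
    also have "\<dots> \<le> ennreal (\<theta> / \<theta> powr p') * ennreal (\<delta> powr (e + 1) / (- (e + 1)))"
      using e \<delta> by (intro mult_left_mono nn_integral_powr_tail_le) auto
    also have "\<dots> = ennreal (\<theta> * (1 / (- (e + 1))))"
      using \<theta> e \<delta> by (subst ennreal_mult[symmetric]) (auto simp: \<theta>p)
    finally show ?thesis .
  qed
  have i2: "(\<integral>\<^sup>+s. T2 s \<partial>lborel) \<le> ennreal \<theta>"
    unfolding T2_def using mult_left_mono[OF gp, of "ennreal \<theta>"] by (subst nn_integral_cmult) auto
  have i3: "(\<integral>\<^sup>+s. T3 s \<partial>lborel) = ennreal (h * (\<delta> powr \<alpha> / \<alpha>))"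
  proof -
    have "(\<integral>\<^sup>+s. T3 s \<partial>lborel) = ennreal h * (\<integral>\<^sup>+s. ennreal (pos_power \<alpha> (t - s)) * indicator {..\<delta>} (t - s) \<partial>lborel)"
      unfolding T3_def by (subst nn_integral_cmult) auto
    also have "\<dots> = ennreal h * ennreal (\<delta> powr \<alpha> / \<alpha>)"
      using \<delta> \<alpha> by (subst nn_integral_reflect[where F="\<lambda>s. ennreal (pos_power \<alpha> s) * indicator {..\<delta>} s"])
        (auto simp: nn_integral_pos_power)
    also have "\<dots> = ennreal (h * (\<delta> powr \<alpha> / \<alpha>))"
      using h \<alpha> by (subst ennreal_mult) auto
    finally show ?thesis .
  qed
  have "frac_conv \<alpha> g t \<le> (\<integral>\<^sup>+s. T1 s + T2 s + T3 s + T4 s \<partial>lborel)"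
    unfolding frac_conv_def by (intro nn_integral_mono pw)
  also have "\<dots> = (\<integral>\<^sup>+s. T1 s \<partial>lborel) + (\<integral>\<^sup>+s. T2 s \<partial>lborel) + (\<integral>\<^sup>+s. T3 s \<partial>lborel) + (\<integral>\<^sup>+s. T4 s \<partial>lborel)"
    by (simp add: nn_integral_add)
  also have "\<dots> \<le> ennreal (\<theta> * (1 / (- (e + 1)))) + ennreal \<theta> + ennreal (h * (\<delta> powr \<alpha> / \<alpha>)) + (\<integral>\<^sup>+s. T4 s \<partial>lborel)"
    using i1 i2 i3 by (intro add_mono) auto
  also have "ennreal (\<theta> * (1 / (- (e + 1)))) + ennreal \<theta> = ennreal (\<theta> * (1 / (- (e + 1)) + 1))"
    using \<theta> e by (subst ennreal_plus[symmetric]) (auto simp: algebra_simps)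
  finally show ?thesis unfolding T4_def \<theta>_def .
qed

text \<open>Prepares Markov's inequality: by Tonelli and translation invariance, every
  \<open>s\<close> contributes the same mass of the truncated kernel.\<close>

lemma nn_integral_frac_conv_near:
  fixes w :: "real \<Rightarrow> ennreal"
  assumes "0 < \<alpha>" "0 \<le> \<delta>" and [measurable]: "w \<in> borel_measurable borel"
  shows "(\<integral>\<^sup>+t. (\<integral>\<^sup>+s. ennreal (pos_power \<alpha> (t - s)) * indicator {..\<delta>} (t - s) * w s \<partial>lborel) \<partial>lborel)
    = ennreal (\<delta> powr \<alpha> / \<alpha>) * (\<integral>\<^sup>+s. w s \<partial>lborel)"
proof -
  have "(\<integral>\<^sup>+t. (\<integral>\<^sup>+s. ennreal (pos_power \<alpha> (t - s)) * indicator {..\<delta>} (t - s) * w s \<partial>lborel) \<partial>lborel)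
      = (\<integral>\<^sup>+s. (\<integral>\<^sup>+t. ennreal (pos_power \<alpha> (t - s)) * indicator {..\<delta>} (t - s) * w s \<partial>lborel) \<partial>lborel)"
    by (rule lborel_pair.Fubini') measurable
  also have "\<dots> = (\<integral>\<^sup>+s. ennreal (\<delta> powr \<alpha> / \<alpha>) * w s \<partial>lborel)"
  proof (rule nn_integral_cong)
    fix s
    have "(\<integral>\<^sup>+t. ennreal (pos_power \<alpha> (t - s)) * indicator {..\<delta>} (t - s) * w s \<partial>lborel)
        = (\<integral>\<^sup>+t. ennreal (pos_power \<alpha> (t - s)) * indicator {..\<delta>} (t - s) \<partial>lborel) * w s"
      by (rule nn_integral_multc) measurable
    also have "(\<integral>\<^sup>+t. ennreal (pos_power \<alpha> (t - s)) * indicator {..\<delta>} (t - s) \<partial>lborel) = ennreal (\<delta> powr \<alpha> / \<alpha>)"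
      using assms by (subst nn_integral_shift[where F="\<lambda>s. ennreal (pos_power \<alpha> s) * indicator {..\<delta>} s"])
        (auto simp: nn_integral_pos_power)
    finally show "(\<integral>\<^sup>+t. ennreal (pos_power \<alpha> (t - s)) * indicator {..\<delta>} (t - s) * w s \<partial>lborel)
        = ennreal (\<delta> powr \<alpha> / \<alpha>) * w s" .
  qed
  also have "\<dots> = ennreal (\<delta> powr \<alpha> / \<alpha>) * (\<integral>\<^sup>+s. w s \<partial>lborel)"
    by (rule nn_integral_cmult) measurable
  finally show ?thesis .
qed

lemma frac_conv_level_set:
  fixes p \<alpha> q :: real
  assumes p: "1 < p" and \<alpha>: "0 < \<alpha>" "\<alpha> < 1 / p"
  defines "q \<equiv> p / (1 - p * \<alpha>)"
  obtains b c where "0 < b" "0 < c"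
    "\<And>(g::real \<Rightarrow> real) l. g \<in> borel_measurable borel \<Longrightarrow> (\<And>s. 0 \<le> g s) \<Longrightarrow>
      (\<integral>\<^sup>+s. ennreal (g s powr p) \<partial>lborel) \<le> 1 \<Longrightarrow> 0 < l \<Longrightarrow>
      emeasure lborel {t. ennreal l \<le> frac_conv \<alpha> g t} \<le>
        ennreal (c * l powr (- (q / p))) * (\<integral>\<^sup>+s. ennreal (g s) * indicator {b * l powr (q / p)<..} (g s) \<partial>lborel)"
proof -
  define e where "e = (\<alpha> - 1) * (p / (p - 1))"
  \<comment> \<open>\<open>D\<close> is four times the factor of the Young term in
    \<open>frac_conv_split\<close>. Then \<open>a = D powr q\<close> makes that term
    \<open>l / 4\<close>, \<open>b\<close> makes the contribution of \<open>g \<le> h\<close>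
    another \<open>l / 4\<close>, and \<open>c\<close> collects the constant of Markov's inequality
    at height \<open>l / 2\<close>.\<close>
  define D where "D = 4 * (1 / (- (e + 1)) + 1)"
  define a where "a = D powr q"
  define b where "b = \<alpha> / (4 * a powr \<alpha>)"
  define c where "c = 2 * a powr \<alpha> / \<alpha>"
  have pa: "p * \<alpha> < 1" using p \<alpha> by (simp add: field_simps)
  have q: "0 < q" using pa p by (simp add: q_def)
  \<comment> \<open>The scaling relation 1/q = 1/p - \<alpha>, from which every exponent of
    \<open>l\<close> below is computed.\<close>
  have q1: "q * (1 / p - \<alpha>) = 1" using p pa by (simp add: q_def field_simps)
  have e: "e < -1"
    using p \<alpha> by (simp add: e_def field_simps)
  have D: "0 < D" using e by (simp add: D_def add_pos_nonneg add_nonneg_pos)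
  have a: "0 < a" using D by (simp add: a_def)
  have bc: "0 < b" "0 < c" using a \<alpha> by (auto simp: b_def c_def)
  moreover have "emeasure lborel {t. ennreal l \<le> frac_conv \<alpha> g t} \<le>
        ennreal (c * l powr (- (q / p))) * (\<integral>\<^sup>+s. ennreal (g s) * indicator {b * l powr (q / p)<..} (g s) \<partial>lborel)"
    if g [measurable]: "g \<in> borel_measurable borel" and g0: "\<And>s. 0 \<le> g s"
      and gp: "(\<integral>\<^sup>+s. ennreal (g s powr p) \<partial>lborel) \<le> 1" and l: "0 < l" for g :: "real \<Rightarrow> real" and l
  proof -
    define \<delta> where "\<delta> = a * l powr (- q)"
    define h where "h = b * l powr (q / p)"
    define N where "N t = (\<integral>\<^sup>+s. ennreal (pos_power \<alpha> (t - s)) * indicator {..\<delta>} (t - s) * (ennreal (g s) * indicator {h<..} (g s)) \<partial>lborel)" for t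
    have [measurable]: "N \<in> borel_measurable borel" unfolding N_def by measurable
    have \<delta>: "0 < \<delta>" using a l by (simp add: \<delta>_def)
    have h: "0 < h" using bc l by (simp add: h_def)
    have "\<delta> powr (\<alpha> - 1 / p) = a powr (\<alpha> - 1 / p) * l powr (- q * (\<alpha> - 1 / p))"
      using a l by (simp add: \<delta>_def powr_mult powr_powr)
    also have "- q * (\<alpha> - 1 / p) = 1" using q1 by (simp add: algebra_simps)
    also have "a powr (\<alpha> - 1 / p) = D powr (q * (\<alpha> - 1 / p))" by (simp add: a_def powr_powr)
    also have "q * (\<alpha> - 1 / p) = - 1" using q1 by (simp add: algebra_simps)
    finally have \<theta>: "\<delta> powr (\<alpha> - 1 / p) = l / D" using l D by (simp add: powr_minus divide_simps)
    then have t1: "\<delta> powr (\<alpha> - 1 / p) * (1 / (- (e + 1)) + 1) = l / 4"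
      using D unfolding \<theta> by (simp add: D_def field_simps)
    have \<delta>\<alpha>: "\<delta> powr \<alpha> = a powr \<alpha> * l powr (- q * \<alpha>)"
      using a l by (simp add: \<delta>_def powr_mult powr_powr)
    have "h * (\<delta> powr \<alpha> / \<alpha>) = (b * a powr \<alpha> / \<alpha>) * (l powr (q / p) * l powr (- q * \<alpha>))"
      by (simp add: h_def \<delta>\<alpha>)
    also have "l powr (q / p) * l powr (- q * \<alpha>) = l"
      using q1 l by (simp add: powr_add[symmetric] algebra_simps)
    also have "b * a powr \<alpha> / \<alpha> = 1 / 4" using a \<alpha> by (simp add: b_def)
    finally have t2: "h * (\<delta> powr \<alpha> / \<alpha>) = l / 4" by simp
    have "{t. ennreal l \<le> frac_conv \<alpha> g t} \<subseteq> {t \<in> UNIV. 1 \<le> ennreal (2 / l) * N t}"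
    proof (safe, simp)
      fix t assume "ennreal l \<le> frac_conv \<alpha> g t"
      also have "\<dots> \<le> ennreal (l / 4) + ennreal (l / 4) + N t"
        using frac_conv_split[OF p \<alpha> \<delta> _ g g0 gp, of h t] h unfolding N_def e_def[symmetric] t1 t2 by simp
      also have "ennreal (l / 4) + ennreal (l / 4) = ennreal (l / 2)"
        using l by (subst ennreal_plus[symmetric]) auto
      finally have *: "ennreal l \<le> ennreal (l / 2) + N t" .
      show "1 \<le> ennreal (2 / l) * N t"
      proof (cases "N t")
        case (real r)
        then have "l \<le> l / 2 + r" using * l by (simp add: ennreal_plus[symmetric] del: ennreal_plus)
        then have "1 \<le> (2 / l) * r" using l by (simp add: field_simps)
        then show ?thesis using real l by (simp add: ennreal_mult[symmetric])
      next
        case top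
        then show ?thesis using l by (simp add: ennreal_mult_top)
      qed
    qed
    then have "emeasure lborel {t. ennreal l \<le> frac_conv \<alpha> g t} \<le> emeasure lborel {t \<in> UNIV. 1 \<le> ennreal (2 / l) * N t}"
      by (intro emeasure_mono) auto
    also have "\<dots> \<le> ennreal (2 / l) * (\<integral>\<^sup>+t. N t * indicator UNIV t \<partial>lborel)"
      by (intro nn_integral_Markov_inequality) auto
    also have "\<dots> = ennreal (2 / l) * (\<integral>\<^sup>+t. N t \<partial>lborel)" by simp
    also have "(\<integral>\<^sup>+t. N t \<partial>lborel) = ennreal (\<delta> powr \<alpha> / \<alpha>) * (\<integral>\<^sup>+s. ennreal (g s) * indicator {h<..} (g s) \<partial>lborel)"
      unfolding N_def using \<alpha> \<delta> by (intro nn_integral_frac_conv_near) auto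
    also have "ennreal (2 / l) * (ennreal (\<delta> powr \<alpha> / \<alpha>) * (\<integral>\<^sup>+s. ennreal (g s) * indicator {h<..} (g s) \<partial>lborel))
      = ennreal ((2 / l) * (\<delta> powr \<alpha> / \<alpha>)) * (\<integral>\<^sup>+s. ennreal (g s) * indicator {h<..} (g s) \<partial>lborel)"
      using \<alpha> l by (subst ennreal_mult) (auto simp: mult.assoc)
    also have "(2 / l) * (\<delta> powr \<alpha> / \<alpha>) = c * (l powr (- 1) * l powr (- q * \<alpha>))"
      using l by (simp add: c_def \<delta>\<alpha> powr_minus divide_simps)
    also have "l powr (- 1) * l powr (- q * \<alpha>) = l powr (- (q / p))"
    proof -
      have "- 1 - q * \<alpha> = - (q / p)" using q1 by (simp add: algebra_simps)
      then show ?thesis by (metis (no_types) powr_add diff_conv_add_uminus mult_minus_left)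
    qed
    finally show ?thesis unfolding h_def .
  qed
  ultimately show ?thesis using that by blast
qed

section \<open>The layer-cake formula and the normalised bound\<close>

lemma layer_cake_powr:
  fixes q :: real and x :: ennreal
  assumes q: "0 < q"
  shows "x < \<infinity> \<Longrightarrow> (\<integral>\<^sup>+l. ennreal (pos_power q l) * indicator {l. ennreal l \<le> x} l \<partial>lborel) = ennreal (enn2real x powr q / q)"
    and "x = \<infinity> \<Longrightarrow> (\<integral>\<^sup>+l. ennreal (pos_power q l) * indicator {l. ennreal l \<le> x} l \<partial>lborel) = \<infinity>"
proof -
  assume "x < \<infinity>"
  then obtain r where r: "x = ennreal r" "0 \<le> r" by (cases x) auto
  have "{l. ennreal l \<le> x} = {..r}"
    using r by (auto simp: ennreal_le_iff2)
  then show "(\<integral>\<^sup>+l. ennreal (pos_power q l) * indicator {l. ennreal l \<le> x} l \<partial>lborel) = ennreal (enn2real x powr q / q)"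
    using r q nn_integral_pos_power[of q r] by simp
next
  \<comment> \<open>This case later yields finiteness almost everywhere from a bound on layer-cake
    integrals; \<open>enn2real\<close> would send \<infinity> to 0 and hide the divergence.\<close>
  assume x: "x = \<infinity>"
  have "ennreal B \<le> (\<integral>\<^sup>+l. ennreal (pos_power q l) * indicator {l. ennreal l \<le> x} l \<partial>lborel)" if "0 < B" for B
  proof -
    \<comment> \<open>The endpoint \<open>(q * B) powr (1 / q)\<close> is the one at which the
      truncated integral equals \<open>B\<close>.\<close>
    have "ennreal B = ennreal (((q * B) powr (1 / q)) powr q / q)"
      using q that by (simp add: powr_powr)
    also have "\<dots> = (\<integral>\<^sup>+l. ennreal (pos_power q l) * indicator {..(q * B) powr (1 / q)} l \<partial>lborel)"
      using q by (simp add: nn_integral_pos_power)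
    also have "\<dots> \<le> (\<integral>\<^sup>+l. ennreal (pos_power q l) * indicator {l. ennreal l \<le> x} l \<partial>lborel)"
      using x by (intro nn_integral_mono) (auto simp: indicator_def)
    finally show ?thesis .
  qed
  note large = this
  show "(\<integral>\<^sup>+l. ennreal (pos_power q l) * indicator {l. ennreal l \<le> x} l \<partial>lborel) = \<infinity>" (is "?I = _")
  proof (cases ?I)
    case (real r)
    then show ?thesis using large[of "r + 1"] by simp
  qed simp
qed

text \<open>For fixed \<open>s\<close>, the condition \<open>b * l powr (q / p) < g s\<close>
  confines \<open>l\<close> to values below \<open>(g s / b) powr (p / q)\<close>. With
  \<open>r = q - q / p\<close>, the weight \<open>l powr (r - 1)\<close> integrates over this range
  to a multiple of \<open>g s powr (p - 1)\<close>, because (p / q) r = p - 1; the remaining factor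
  \<open>g s\<close> completes the power \<open>p\<close>. The layer-cake form is used because
  \<open>frac_conv\<close> may still be infinite at this stage.\<close>

lemma frac_conv_layer_cake_le:
  fixes p \<alpha> :: real
  assumes p: "1 < p" and \<alpha>: "0 < \<alpha>" "\<alpha> < 1 / p"
  defines "q \<equiv> p / (1 - p * \<alpha>)"
  obtains C where "0 < C"
    "\<And>g::real \<Rightarrow> real. g \<in> borel_measurable borel \<Longrightarrow> (\<And>s. 0 \<le> g s) \<Longrightarrow>
      (\<integral>\<^sup>+s. ennreal (g s powr p) \<partial>lborel) \<le> 1 \<Longrightarrow>
      (\<integral>\<^sup>+t. (\<integral>\<^sup>+l. ennreal (pos_power q l) * indicator {l. ennreal l \<le> frac_conv \<alpha> g t} l \<partial>lborel) \<partial>lborel)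
        \<le> ennreal C"
proof -
  obtain b c where bc: "0 < b" "0 < c"
    and level: "\<And>(g::real \<Rightarrow> real) l. g \<in> borel_measurable borel \<Longrightarrow> (\<And>s. 0 \<le> g s) \<Longrightarrow>
      (\<integral>\<^sup>+s. ennreal (g s powr p) \<partial>lborel) \<le> 1 \<Longrightarrow> 0 < l \<Longrightarrow>
      emeasure lborel {t. ennreal l \<le> frac_conv \<alpha> g t} \<le>
        ennreal (c * l powr (- (q / p))) * (\<integral>\<^sup>+s. ennreal (g s) * indicator {b * l powr (q / p)<..} (g s) \<partial>lborel)"
    unfolding q_def by (rule frac_conv_level_set[OF p \<alpha>]) blast
  \<comment> \<open>The weight \<open>l powr (q - 1)\<close> times the decay
    \<open>l powr (- (q / p))\<close> of the level-set bound is \<open>l powr (r - 1)\<close>.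
    Positivity of \<open>r\<close>, which comes from \<open>1 < p\<close>, makes this integrable at
    0.\<close>
  define r where "r = q - q / p"
  define C where "C = c * b powr (1 - p) / r"
  have pa: "p * \<alpha> < 1" using p \<alpha> by (simp add: field_simps)
  have q: "0 < q" using pa p by (simp add: q_def)
  have r: "0 < r" using q p by (simp add: r_def field_simps)
  have pr: "p / q * r = p - 1" using q p by (simp add: r_def field_simps)
  have "0 < C" using bc r by (simp add: C_def)
  moreover have "(\<integral>\<^sup>+t. (\<integral>\<^sup>+l. ennreal (pos_power q l) * indicator {l. ennreal l \<le> frac_conv \<alpha> g t} l \<partial>lborel) \<partial>lborel)
        \<le> ennreal C"
    if g [measurable]: "g \<in> borel_measurable borel" and g0: "\<And>s. 0 \<le> g s"
      and gp: "(\<integral>\<^sup>+s. ennreal (g s powr p) \<partial>lborel) \<le> 1" for g :: "real \<Rightarrow> real"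
  proof -
    have "(\<integral>\<^sup>+t. (\<integral>\<^sup>+l. ennreal (pos_power q l) * indicator {l. ennreal l \<le> frac_conv \<alpha> g t} l \<partial>lborel) \<partial>lborel)
        = (\<integral>\<^sup>+l. (\<integral>\<^sup>+t. ennreal (pos_power q l) * indicator {t. ennreal l \<le> frac_conv \<alpha> g t} t \<partial>lborel) \<partial>lborel)"
    proof -
      have "(\<integral>\<^sup>+t. (\<integral>\<^sup>+l. ennreal (pos_power q l) * indicator {l. ennreal l \<le> frac_conv \<alpha> g t} l \<partial>lborel) \<partial>lborel)
        = (\<integral>\<^sup>+l. (\<integral>\<^sup>+t. ennreal (pos_power q l) * indicator {l. ennreal l \<le> frac_conv \<alpha> g t} l \<partial>lborel) \<partial>lborel)"
        by (rule lborel_pair.Fubini') measurable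
      then show ?thesis by (simp add: indicator_def)
    qed
    also have "\<dots> = (\<integral>\<^sup>+l. ennreal (pos_power q l) * emeasure lborel {t. ennreal l \<le> frac_conv \<alpha> g t} \<partial>lborel)"
      by (intro nn_integral_cong nn_integral_cmult_indicator) measurable
    also have "\<dots> \<le> (\<integral>\<^sup>+l. (\<integral>\<^sup>+s. ennreal (c * pos_power r l) * (ennreal (g s) * indicator {b * l powr (q / p)<..} (g s)) \<partial>lborel) \<partial>lborel)"
    proof (rule nn_integral_mono)
      fix l :: real
      show "ennreal (pos_power q l) * emeasure lborel {t. ennreal l \<le> frac_conv \<alpha> g t}
        \<le> (\<integral>\<^sup>+s. ennreal (c * pos_power r l) * (ennreal (g s) * indicator {b * l powr (q / p)<..} (g s)) \<partial>lborel)"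
      proof (cases "0 < l")
        case True
        have "ennreal (pos_power q l) * emeasure lborel {t. ennreal l \<le> frac_conv \<alpha> g t}
          \<le> ennreal (pos_power q l) * (ennreal (c * l powr (- (q / p))) * (\<integral>\<^sup>+s. ennreal (g s) * indicator {b * l powr (q / p)<..} (g s) \<partial>lborel))"
          using level[OF g g0 gp True] by (intro mult_left_mono) auto
        also have "\<dots> = ennreal (pos_power q l * (c * l powr (- (q / p)))) * (\<integral>\<^sup>+s. ennreal (g s) * indicator {b * l powr (q / p)<..} (g s) \<partial>lborel)"
          using bc by (subst ennreal_mult) (auto simp: mult.assoc)
        also have "pos_power q l * (c * l powr (- (q / p))) = c * pos_power r l"
          using True by (simp add: pos_power_def r_def powr_add[symmetric] algebra_simps)
        also have "ennreal (c * pos_power r l) * (\<integral>\<^sup>+s. ennreal (g s) * indicator {b * l powr (q / p)<..} (g s) \<partial>lborel)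
          = (\<integral>\<^sup>+s. ennreal (c * pos_power r l) * (ennreal (g s) * indicator {b * l powr (q / p)<..} (g s)) \<partial>lborel)"
          by (rule nn_integral_cmult[symmetric]) measurable
        finally show ?thesis .
      qed (simp add: pos_power_def)
    qed
    also have "\<dots> = (\<integral>\<^sup>+s. (\<integral>\<^sup>+l. ennreal (c * pos_power r l) * (ennreal (g s) * indicator {b * l powr (q / p)<..} (g s)) \<partial>lborel) \<partial>lborel)"
      unfolding indicator_def greaterThan_iff by (rule lborel_pair.Fubini') measurable
    also have "\<dots> \<le> (\<integral>\<^sup>+s. ennreal C * ennreal (g s powr p) \<partial>lborel)"
    proof (rule nn_integral_mono)
      fix s
      define x where "x = (g s / b) powr (p / q)"
      have "(\<integral>\<^sup>+l. ennreal (c * pos_power r l) * (ennreal (g s) * indicator {b * l powr (q / p)<..} (g s)) \<partial>lborel)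
         \<le> (\<integral>\<^sup>+l. ennreal (c * g s) * (ennreal (pos_power r l) * indicator {..x} l) \<partial>lborel)"
      proof (rule nn_integral_mono)
        fix l :: real
        have "l \<le> x" if "0 < l" "b * l powr (q / p) < g s"
        proof -
          have "l = (l powr (q / p)) powr (p / q)" using q p that by (simp add: powr_powr)
          also have "\<dots> \<le> x" unfolding x_def
            using that bc q p by (intro powr_mono2) (auto simp: field_simps)
          finally show ?thesis .
        qed
        then show "ennreal (c * pos_power r l) * (ennreal (g s) * indicator {b * l powr (q / p)<..} (g s))
          \<le> ennreal (c * g s) * (ennreal (pos_power r l) * indicator {..x} l)"
          using bc g0[of s] by (cases "0 < l") (auto simp: indicator_def ennreal_mult[symmetric] pos_power_def mult_ac)
      qed
      also have "\<dots> = ennreal (c * g s) * ennreal (x powr r / r)"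
        using r by (subst nn_integral_cmult) (auto simp: nn_integral_pos_power x_def)
      also have "\<dots> = ennreal (c * g s * (x powr r / r))"
        using bc g0[of s] r by (subst ennreal_mult[symmetric]) auto
      also have "c * g s * (x powr r / r) = C * g s powr p"
      proof (cases "g s = 0")
        case False
        then have gs: "0 < g s" using g0[of s] by simp
        have "x powr r = (g s / b) powr (p - 1)" by (simp only: x_def powr_powr pr)
        also have "\<dots> = g s powr p / g s * b powr (1 - p)"
          using gs bc by (simp add: powr_divide powr_diff)
        finally show ?thesis using gs by (simp add: C_def)
      qed (use p in simp)
      finally show "(\<integral>\<^sup>+l. ennreal (c * pos_power r l) * (ennreal (g s) * indicator {b * l powr (q / p)<..} (g s)) \<partial>lborel)
        \<le> ennreal C * ennreal (g s powr p)"
        using \<open>0 < C\<close> by (simp add: ennreal_mult)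
    qed
    also have "\<dots> = ennreal C * (\<integral>\<^sup>+s. ennreal (g s powr p) \<partial>lborel)"
      by (rule nn_integral_cmult) measurable
    also have "\<dots> \<le> ennreal C * 1"
      by (intro mult_left_mono gp) auto
    finally show ?thesis by simp
  qed
  ultimately show ?thesis using that by blast
qed

section \<open>Homogeneity and removal of the normalisation\<close>

lemma frac_conv_cmult:
  assumes "0 \<le> a" and [measurable]: "g \<in> borel_measurable borel"
  shows "frac_conv \<alpha> (\<lambda>s. a * g s) t = ennreal a * frac_conv \<alpha> g t"
proof -
  have "frac_conv \<alpha> (\<lambda>s. a * g s) t = (\<integral>\<^sup>+s. ennreal a * ennreal (pos_power \<alpha> (t - s) * g s) \<partial>lborel)"
    unfolding frac_conv_def using assms(1) 
    by (intro nn_integral_cong) (simp add: ennreal_mult'[symmetric] mult_ac)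
  then show ?thesis
    unfolding frac_conv_def by (simp add: nn_integral_cmult)
qed

lemma frac_conv_cong_AE:
  "AE s in lborel. f s = g s \<Longrightarrow> frac_conv \<alpha> f = frac_conv \<alpha> g"
  unfolding frac_conv_def by (intro ext nn_integral_cong_AE) auto

text \<open>Dividing by \<open>A\<close> reduces to the normalised case; for \<open>A = 0\<close>
  the function vanishes almost everywhere. Finiteness almost everywhere is part of the conclusion
  because \<open>enn2real\<close> maps \<infinity> to 0, so the integral bound alone would not
  exclude divergence.\<close>

lemma hardy_littlewood_sobolev_borel:
  fixes p \<alpha> :: real
  assumes p: "1 < p" and \<alpha>: "0 < \<alpha>" "\<alpha> < 1 / p"
  defines "q \<equiv> p / (1 - p * \<alpha>)"
  obtains C where "0 < C"
    "\<And>(g::real \<Rightarrow> real) A. g \<in> borel_measurable borel \<Longrightarrow> (\<And>s. 0 \<le> g s) \<Longrightarrow> 0 \<le> A \<Longrightarrow>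
      (\<integral>\<^sup>+s. ennreal (g s powr p) \<partial>lborel) \<le> ennreal (A powr p) \<Longrightarrow>
      (AE t in lborel. frac_conv \<alpha> g t < \<infinity>) \<and>
      (\<integral>\<^sup>+t. ennreal (enn2real (frac_conv \<alpha> g t) powr q) \<partial>lborel) \<le> ennreal (C * A powr q)"
proof -
  obtain K where K: "0 < K" and bound: "\<And>g::real \<Rightarrow> real. g \<in> borel_measurable borel \<Longrightarrow> (\<And>s. 0 \<le> g s) \<Longrightarrow>
      (\<integral>\<^sup>+s. ennreal (g s powr p) \<partial>lborel) \<le> 1 \<Longrightarrow>
      (\<integral>\<^sup>+t. (\<integral>\<^sup>+l. ennreal (pos_power q l) * indicator {l. ennreal l \<le> frac_conv \<alpha> g t} l \<partial>lborel) \<partial>lborel)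
        \<le> ennreal K"
    unfolding q_def by (rule frac_conv_layer_cake_le[OF p \<alpha>]) blast
  have pa: "p * \<alpha> < 1" using p \<alpha> by (simp add: field_simps)
  have q: "0 < q" using pa p by (simp add: q_def)
  have normalised: "(AE t in lborel. frac_conv \<alpha> g t < \<infinity>) \<and>
      (\<integral>\<^sup>+t. ennreal (enn2real (frac_conv \<alpha> g t) powr q) \<partial>lborel) \<le> ennreal (q * K)"
    if g [measurable]: "g \<in> borel_measurable borel" and g0: "\<And>s. 0 \<le> g s"
      and gp: "(\<integral>\<^sup>+s. ennreal (g s powr p) \<partial>lborel) \<le> 1" for g :: "real \<Rightarrow> real"
  proof -
    define L where "L t = (\<integral>\<^sup>+l. ennreal (pos_power q l) * indicator {l. ennreal l \<le> frac_conv \<alpha> g t} l \<partial>lborel)" for t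
    have [measurable]: "L \<in> borel_measurable borel" 
    proof -
      have "(\<lambda>t. (\<integral>\<^sup>+l. ennreal (pos_power q l) * (if ennreal l \<le> frac_conv \<alpha> g t then 1 else 0) \<partial>lborel)) \<in> borel_measurable borel"
        by measurable
      then show ?thesis unfolding L_def by (simp add: indicator_def)
    qed
    have L: "(\<integral>\<^sup>+t. L t \<partial>lborel) \<le> ennreal K"
      unfolding L_def by (rule bound[OF g g0 gp])
    then have "AE t in lborel. L t \<noteq> \<infinity>"
      by (intro nn_integral_noteq_infinite) (auto simp: top_unique)
    then have fin: "AE t in lborel. frac_conv \<alpha> g t < \<infinity>"
    proof eventually_elim
      case (elim t)
      then have "frac_conv \<alpha> g t \<noteq> \<infinity>"
        using layer_cake_powr(2)[OF q, of "frac_conv \<alpha> g t"] unfolding L_def by blast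
      then show ?case by (simp add: less_top)
    qed
    then have "(\<integral>\<^sup>+t. ennreal (enn2real (frac_conv \<alpha> g t) powr q) \<partial>lborel) = (\<integral>\<^sup>+t. ennreal q * L t \<partial>lborel)"
      by (intro nn_integral_cong_AE, eventually_elim)
        (use q layer_cake_powr(1)[OF q] in \<open>simp add: L_def ennreal_mult[symmetric]\<close>)
    also have "\<dots> = ennreal q * (\<integral>\<^sup>+t. L t \<partial>lborel)"
      by (rule nn_integral_cmult) measurable
    also have "\<dots> \<le> ennreal q * ennreal K"
      by (intro mult_left_mono L) auto
    finally show ?thesis using fin q K by (simp add: ennreal_mult)
  qed
  have "(AE t in lborel. frac_conv \<alpha> g t < \<infinity>) \<and>
      (\<integral>\<^sup>+t. ennreal (enn2real (frac_conv \<alpha> g t) powr q) \<partial>lborel) \<le> ennreal (q * K * A powr q)"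
    if g [measurable]: "g \<in> borel_measurable borel" and g0: "\<And>s. 0 \<le> g s" and A: "0 \<le> A"
      and gp: "(\<integral>\<^sup>+s. ennreal (g s powr p) \<partial>lborel) \<le> ennreal (A powr p)" for g :: "real \<Rightarrow> real" and A
  proof (cases "A = 0")
    case True
    then have "(\<integral>\<^sup>+s. ennreal (g s powr p) \<partial>lborel) = 0" using gp p by simp
    then have "AE s in lborel. ennreal (g s powr p) = 0"
      by (subst (asm) nn_integral_0_iff_AE) auto
    then have "AE s in lborel. g s = 0"
      by eventually_elim (use g0 in \<open>simp add: ennreal_eq_0_iff\<close>)
    then have "frac_conv \<alpha> g = frac_conv \<alpha> (\<lambda>_. 0)"
      by (intro frac_conv_cong_AE) auto
    then have "frac_conv \<alpha> g t = 0" for t by (simp add: frac_conv_def)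
    then show ?thesis by simp
  next
    case False
    with A have A: "0 < A" by simp
    define h where "h s = inverse A * g s" for s
    have [measurable]: "h \<in> borel_measurable borel" unfolding h_def by measurable
    have h0: "0 \<le> h s" for s using A g0 by (simp add: h_def)
    have "(\<integral>\<^sup>+s. ennreal (h s powr p) \<partial>lborel) = (\<integral>\<^sup>+s. ennreal (inverse A powr p) * ennreal (g s powr p) \<partial>lborel)"
      using A g0 by (simp add: h_def powr_mult ennreal_mult)
    also have "\<dots> = ennreal (inverse A powr p) * (\<integral>\<^sup>+s. ennreal (g s powr p) \<partial>lborel)"
      by (rule nn_integral_cmult) measurable
    also have "\<dots> \<le> ennreal (inverse A powr p) * ennreal (A powr p)"
      by (intro mult_left_mono gp) auto
    also have "\<dots> = 1"
      using A by (simp add: ennreal_mult[symmetric] powr_mult[symmetric])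
    finally have "(\<integral>\<^sup>+s. ennreal (h s powr p) \<partial>lborel) \<le> 1" .
    from normalised[OF _ h0 this] have *: "AE t in lborel. frac_conv \<alpha> h t < \<infinity>"
      "(\<integral>\<^sup>+t. ennreal (enn2real (frac_conv \<alpha> h t) powr q) \<partial>lborel) \<le> ennreal (q * K)" by auto
    have "g = (\<lambda>s. A * h s)" using A by (auto simp: h_def)
    then have gh: "frac_conv \<alpha> g t = ennreal A * frac_conv \<alpha> h t" for t
      using A by (simp add: frac_conv_cmult)
    have "(\<integral>\<^sup>+t. ennreal (enn2real (frac_conv \<alpha> g t) powr q) \<partial>lborel)
      = (\<integral>\<^sup>+t. ennreal (A powr q) * ennreal (enn2real (frac_conv \<alpha> h t) powr q) \<partial>lborel)"
      using A by (simp add: gh enn2real_mult powr_mult ennreal_mult)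
    also have "\<dots> = ennreal (A powr q) * (\<integral>\<^sup>+t. ennreal (enn2real (frac_conv \<alpha> h t) powr q) \<partial>lborel)"
      by (rule nn_integral_cmult) measurable
    also have "\<dots> \<le> ennreal (A powr q) * ennreal (q * K)"
      by (intro mult_left_mono *) auto
    also have "\<dots> = ennreal (q * K * A powr q)"
      using q K by (simp add: ennreal_mult[symmetric] mult_ac)
    finally have "(\<integral>\<^sup>+t. ennreal (enn2real (frac_conv \<alpha> g t) powr q) \<partial>lborel) \<le> ennreal (q * K * A powr q)" .
    moreover have "AE t in lborel. frac_conv \<alpha> g t < \<infinity>"
      using *(1) by eventually_elim (simp add: gh ennreal_mult_less_top)
    ultimately show ?thesis by blast
  qed
  then show ?thesis using that[of "q * K"] q K by (simp add: mult_ac)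
qed

text \<open>Tonelli's theorem is applied to Borel functions on \<open>lborel\<close>, while the norm
  of \<open>f\<close> is only Lebesgue measurable. The absolute value of a Borel representative is
  nonnegative everywhere, and a null set of \<open>s\<close> does not change the convolution at any
  point.\<close>

lemma frac_conv_borel_representative:
  fixes g :: "real \<Rightarrow> real"
  assumes g: "g \<in> borel_measurable lebesgue" and g0: "\<And>s. 0 \<le> g s"
  obtains g' where "g' \<in> borel_measurable borel" "\<And>s. 0 \<le> g' s" "AE s in lborel. g s = g' s"
    "\<And>\<alpha>. frac_conv \<alpha> g = frac_conv \<alpha> g'"
proof -
  obtain h where h: "h \<in> borel_measurable lborel" "AE s in lborel. g s = h s"
    using completion_ex_borel_measurable_real[OF g] by blast
  from h(2) have eq: "AE s in lborel. g s = \<bar>h s\<bar>"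
    by eventually_elim (metis abs_of_nonneg g0)
  show ?thesis
    by (rule that[of "\<lambda>s. \<bar>h s\<bar>"]) (use h(1) eq frac_conv_cong_AE[OF eq] in auto)
qed

lemma frac_conv_lebesgue_measurable:
  fixes g :: "real \<Rightarrow> real"
  assumes "g \<in> borel_measurable lebesgue" "\<And>s. 0 \<le> g s"
  shows "frac_conv \<alpha> g \<in> borel_measurable borel"
  by (rule frac_conv_borel_representative[OF assms]) auto

text \<open>A predicate in \<open>C\<close>, so that one constant, chosen before any interval, can
  be passed to the lemmas about \<open>I\<close>. This is how the final constant becomes independent
  of \<open>I\<close>.\<close>

definition hls_bound :: "real \<Rightarrow> real \<Rightarrow> real \<Rightarrow> real \<Rightarrow> bool" where
  "hls_bound \<alpha> p q C \<longleftrightarrow> (\<forall>g A. g \<in> borel_measurable lebesgue \<longrightarrow> (\<forall>s. 0 \<le> g s) \<longrightarrow> 0 \<le> A \<longrightarrow>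
      (\<integral>\<^sup>+s. ennreal (g s powr p) \<partial>lborel) \<le> ennreal (A powr p) \<longrightarrow>
      (AE t in lborel. frac_conv \<alpha> g t < \<infinity>) \<and>
      (\<integral>\<^sup>+t. ennreal (enn2real (frac_conv \<alpha> g t) powr q) \<partial>lborel) \<le> ennreal (C * A powr q))"

lemma hardy_littlewood_sobolev:
  fixes p \<alpha> :: real
  assumes p: "1 < p" and \<alpha>: "0 < \<alpha>" "\<alpha> < 1 / p"
  defines "q \<equiv> p / (1 - p * \<alpha>)"
  obtains C where "0 < C" "hls_bound \<alpha> p q C"
proof -
  obtain C where C: "0 < C" and bound: "\<And>(g::real \<Rightarrow> real) A. g \<in> borel_measurable borel \<Longrightarrow> (\<And>s. 0 \<le> g s) \<Longrightarrow> 0 \<le> A \<Longrightarrow>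
      (\<integral>\<^sup>+s. ennreal (g s powr p) \<partial>lborel) \<le> ennreal (A powr p) \<Longrightarrow>
      (AE t in lborel. frac_conv \<alpha> g t < \<infinity>) \<and>
      (\<integral>\<^sup>+t. ennreal (enn2real (frac_conv \<alpha> g t) powr q) \<partial>lborel) \<le> ennreal (C * A powr q)"
    unfolding q_def by (rule hardy_littlewood_sobolev_borel[OF p \<alpha>]) blast
  show ?thesis
  proof (rule that[OF C], unfold hls_bound_def, intro allI impI)
    fix g :: "real \<Rightarrow> real" and A
    assume g: "g \<in> borel_measurable lebesgue" and g0: "\<forall>s. 0 \<le> g s" and A: "0 \<le> A"
      and gp: "(\<integral>\<^sup>+s. ennreal (g s powr p) \<partial>lborel) \<le> ennreal (A powr p)"
    obtain g' where g': "g' \<in> borel_measurable borel" "\<And>s. 0 \<le> g' s" "AE s in lborel. g s = g' s"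
      and eq: "\<And>\<alpha>. frac_conv \<alpha> g = frac_conv \<alpha> g'"
      by (rule frac_conv_borel_representative[OF g g0[rule_format]]) blast
    have "(\<integral>\<^sup>+s. ennreal (g' s powr p) \<partial>lborel) = (\<integral>\<^sup>+s. ennreal (g s powr p) \<partial>lborel)"
      by (rule nn_integral_cong_AE) (use g'(3) in eventually_elim, simp)
    with gp have "(\<integral>\<^sup>+s. ennreal (g' s powr p) \<partial>lborel) \<le> ennreal (A powr p)" by simp
    from bound[OF g'(1,2) A this]
    show "(AE t in lborel. frac_conv \<alpha> g t < \<infinity>) \<and>
      (\<integral>\<^sup>+t. ennreal (enn2real (frac_conv \<alpha> g t) powr q) \<partial>lborel) \<le> ennreal (C * A powr q)"
      by (simp only: eq)
  qed
qed

section \<open>Bochner integration over complete measures\<close>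

abbreviation simple_integrable :: "'a measure \<Rightarrow> ('a \<Rightarrow> 'b::real_normed_vector) \<Rightarrow> bool" where
  "simple_integrable \<equiv> Bochner_Integration.simple_bochner_integrable"

abbreviation simple_integral :: "'a measure \<Rightarrow> ('a \<Rightarrow> 'b::real_normed_vector) \<Rightarrow> 'b" where
  "simple_integral \<equiv> Bochner_Integration.simple_bochner_integral"

lemma complete_measure_restrict_space:
  assumes "complete_measure M" and \<Omega>: "\<Omega> \<in> sets M"
  shows "complete_measure (restrict_space M \<Omega>)"
proof
  fix A B assume "B \<subseteq> A" "A \<in> null_sets (restrict_space M \<Omega>)"
  then have "A \<in> null_sets M" "B \<subseteq> \<Omega>"
    using \<Omega> by (auto simp: null_sets_restrict_space)
  then show "B \<in> sets (restrict_space M \<Omega>)"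
    using complete_measure.complete[OF assms(1) \<open>B \<subseteq> A\<close>] \<Omega>
    by (simp add: sets_restrict_space_iff)
qed

lemma complete_measure_lebesgue_on: "S \<in> sets lebesgue \<Longrightarrow> complete_measure (lebesgue_on S)"
  by (intro complete_measure_restrict_space completion.complete_measure_axioms)

lemma (in complete_measure) borel_measurable_cong_AE:
  assumes eq: "AE x in M. f x = g x" and g: "g \<in> borel_measurable M"
  shows "f \<in> borel_measurable M"
proof (rule measurableI)
  fix A :: "'b set" assume "A \<in> sets borel"
  then have "g -` A \<inter> space M \<in> sets M" by (rule measurable_sets[OF g])
  moreover have "AE x in M. x \<in> g -` A \<inter> space M \<longleftrightarrow> x \<in> f -` A \<inter> space M"
    using eq by eventually_elim auto
  ultimately show "f -` A \<inter> space M \<in> sets M"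
    using in_sets_AE[of "g -` A \<inter> space M" "f -` A \<inter> space M"] by simp
qed simp

lemma simple_integrable_norm_measurable:
  assumes "simple_integrable M s"
  shows "(\<lambda>x. norm (s x)) \<in> borel_measurable M"
proof -
  have "simple_function M s" using assms by (rule Bochner_Integration.simple_bochner_integrable.cases) assumption
  then have "simple_function M (\<lambda>x. norm (s x))" by (rule simple_function_compose1)
  then show ?thesis by (rule borel_measurable_simple_function)
qed

lemma simple_integrable_subset:
  assumes s: "simple_integrable M s" and "simple_function M t"
    and sub: "\<And>x. x \<in> space M \<Longrightarrow> t x \<noteq> 0 \<Longrightarrow> s x \<noteq> 0"
  shows "simple_integrable M t"
proof (rule Bochner_Integration.simple_bochner_integrable.intros)
  have "simple_function M s" using s by (rule Bochner_Integration.simple_bochner_integrable.cases) assumption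
  \<comment> \<open>Only finitely many values occur, so the preimage of an arbitrary set of values
    is measurable.\<close>
  then have "s -` (- {0}) \<inter> space M \<in> sets M"
    by (rule simple_functionD(2))
  also have "s -` (- {0}) \<inter> space M = {x \<in> space M. s x \<noteq> 0}" by auto
  finally have "{x \<in> space M. s x \<noteq> 0} \<in> sets M" .
  then have "emeasure M {x \<in> space M. t x \<noteq> 0} \<le> emeasure M {x \<in> space M. s x \<noteq> 0}"
    using sub by (intro emeasure_mono) auto
  moreover have "emeasure M {x \<in> space M. s x \<noteq> 0} \<noteq> \<infinity>"
    using s by (rule Bochner_Integration.simple_bochner_integrable.cases) assumption
  ultimately show "emeasure M {x \<in> space M. t x \<noteq> 0} \<noteq> \<infinity>"
    by (auto simp: top_unique)
qed fact

section \<open>Closure properties of Bochner measurability\<close>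

lemma Bochner_measurable_simple: "simple_integrable M s \<Longrightarrow> Bochner_measurable M s"
  unfolding Bochner_measurable_def by (intro exI[of _ "\<lambda>_. s"]) auto

lemma Bochner_measurable_cong_AE:
  assumes "AE x in M. f x = g x" "Bochner_measurable M f"
  shows "Bochner_measurable M g"
proof -
  obtain s where s: "\<And>i::nat. simple_integrable M (s i)" "AE x in M. (\<lambda>i. s i x) \<longlonglongrightarrow> f x"
    using assms(2) unfolding Bochner_measurable_def by blast
  from s(2) assms(1) have "AE x in M. (\<lambda>i. s i x) \<longlonglongrightarrow> g x" by eventually_elim simp
  with s(1) show ?thesis unfolding Bochner_measurable_def by blast
qed

text \<open>The condition \<open>h 0 0 = 0\<close> keeps the support of the composed simple
  functions inside the union of two sets of finite measure.\<close>

lemma Bochner_measurable_compose2: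
  assumes f: "Bochner_measurable M f" and g: "Bochner_measurable M g"
    and 0: "h 0 0 = 0"
    and lim: "\<And>X Y a b. X \<longlonglongrightarrow> a \<Longrightarrow> Y \<longlonglongrightarrow> b \<Longrightarrow> (\<lambda>i::nat. h (X i) (Y i)) \<longlonglongrightarrow> h a b"
  shows "Bochner_measurable M (\<lambda>x. h (f x) (g x))"
proof -
  obtain s where s: "\<And>i::nat. simple_integrable M (s i)" "AE x in M. (\<lambda>i. s i x) \<longlonglongrightarrow> f x"
    using f unfolding Bochner_measurable_def by blast
  obtain t where t: "\<And>i::nat. simple_integrable M (t i)" "AE x in M. (\<lambda>i. t i x) \<longlonglongrightarrow> g x"
    using g unfolding Bochner_measurable_def by blast
  have "AE x in M. (\<lambda>i. h (s i x) (t i x)) \<longlonglongrightarrow> h (f x) (g x)"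
    using s(2) t(2) by eventually_elim (rule lim)
  moreover have "simple_integrable M (\<lambda>x. h (s i x) (t i x))" for i
    by (rule simple_bochner_integrable_compose2[OF _ s(1) t(1)]) (rule 0)
  ultimately show ?thesis unfolding Bochner_measurable_def by (intro exI[of _ "\<lambda>i x. h (s i x) (t i x)"]) auto
qed

lemma Bochner_measurable_add:
  "Bochner_measurable M f \<Longrightarrow> Bochner_measurable M g \<Longrightarrow> Bochner_measurable M (\<lambda>x. f x + g x)"
  by (rule Bochner_measurable_compose2) (auto intro: tendsto_add)

lemma Bochner_measurable_diff:
  "Bochner_measurable M f \<Longrightarrow> Bochner_measurable M g \<Longrightarrow> Bochner_measurable M (\<lambda>x. f x - g x)"
  by (rule Bochner_measurable_compose2) (auto intro: tendsto_diff)

lemma Bochner_measurable_scaleR: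
  "Bochner_measurable M f \<Longrightarrow> Bochner_measurable M g \<Longrightarrow> Bochner_measurable M (\<lambda>x. f x *\<^sub>R g x)"
  by (rule Bochner_measurable_compose2) (auto intro: tendsto_scaleR)

lemma Bochner_measurable_linear:
  assumes T: "bounded_linear T" and f: "Bochner_measurable M f"
  shows "Bochner_measurable M (\<lambda>x. T (f x))"
proof (rule Bochner_measurable_compose2[OF f f, of "\<lambda>x _. T x"])
  show "T 0 = 0" by (rule linear_simps(3)[OF T])
qed (rule bounded_linear.tendsto[OF T])

text \<open>Pointwise simple approximants may have supports of infinite measure. Multiplying them by
  the indicators of an increasing exhaustion by sets of finite measure repairs this, and at each
  point they are eventually unchanged. This makes the kernel and the scalar majorants available as
  Bochner measurable functions.\<close>

lemma Bochner_measurable_borel: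
  fixes \<phi> :: "'a \<Rightarrow> real"
  assumes M: "sigma_finite_measure M" and \<phi>: "\<phi> \<in> borel_measurable M"
  shows "Bochner_measurable M \<phi>"
proof -
  obtain A :: "nat \<Rightarrow> 'a set" where A: "range A \<subseteq> sets M" "(\<Union>i. A i) = space M"
    "\<And>i. emeasure M (A i) \<noteq> \<infinity>" "incseq A"
    by (rule sigma_finite_measure.sigma_finite_incseq[OF M]) (rule that)
  obtain F where F: "\<And>i::nat. simple_function M (F i)" "\<And>x. x \<in> space M \<Longrightarrow> (\<lambda>i. F i x) \<longlonglongrightarrow> \<phi> x"
    using borel_measurable_implies_sequence_metric[OF \<phi>, of 0] by blast
  define s where "s i x = indicator (A i) x * F i x" for i x
  have "simple_integrable M (s i)" for i
  proof (rule Bochner_Integration.simple_bochner_integrable.intros)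
    show "simple_function M (s i)"
      unfolding s_def using A(1) F(1) by (intro simple_function_mult simple_function_indicator) auto
    have "emeasure M {x \<in> space M. s i x \<noteq> 0} \<le> emeasure M (A i)"
      using A(1) by (intro emeasure_mono) (auto simp: s_def indicator_def split: if_splits)
    then show "emeasure M {x \<in> space M. s i x \<noteq> 0} \<noteq> \<infinity>"
      using A(3)[of i] by (auto simp: top_unique)
  qed
  moreover have "(\<lambda>i. s i x) \<longlonglongrightarrow> \<phi> x" if x: "x \<in> space M" for x
  proof -
    obtain n where "x \<in> A n" using x A(2) by auto
    then have "x \<in> A i" if "n \<le> i" for i
      using A(4) that by (auto dest: incseqD)
    then have "\<forall>\<^sub>F i in sequentially. F i x = s i x"
      by (auto simp: eventually_sequentially s_def intro!: exI[of _ n])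
    with F(2)[OF x] show ?thesis by (rule Lim_transform_eventually)
  qed
  ultimately show ?thesis
    unfolding Bochner_measurable_def by (intro exI[of _ s]) auto
qed

lemma Bochner_measurable_restrict_space:
  assumes \<Omega>: "\<Omega> \<in> sets M" and f: "Bochner_measurable M f"
  shows "Bochner_measurable (restrict_space M \<Omega>) f"
proof -
  obtain s where s: "\<And>i::nat. simple_integrable M (s i)" "AE x in M. (\<lambda>i. s i x) \<longlonglongrightarrow> f x"
    using f unfolding Bochner_measurable_def by blast
  have \<Omega>': "\<Omega> \<inter> space M \<in> sets M" using \<Omega> by auto
  have "simple_integrable (restrict_space M \<Omega>) (s i)" for i
    unfolding simple_bochner_integrable_restrict_space[OF \<Omega>']
  proof (rule simple_integrable_subset[OF s(1)[of i]])
    have "simple_function M (s i)" using s(1) by (rule Bochner_Integration.simple_bochner_integrable.cases) assumption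
    then show "simple_function M (\<lambda>x. indicator \<Omega> x *\<^sub>R s i x)"
      using simple_function_compose2[OF simple_function_indicator[OF \<Omega>], of "s i" scaleR] by simp
  qed auto
  moreover have "AE x in restrict_space M \<Omega>. (\<lambda>i. s i x) \<longlonglongrightarrow> f x"
    using s(2) by (subst AE_restrict_space_iff[OF \<Omega>']) (auto elim!: eventually_mono)
  ultimately show ?thesis unfolding Bochner_measurable_def by blast
qed

section \<open>Measurability of norms and density of simple functions\<close>

lemma (in complete_measure) Bochner_measurable_norm:
  assumes "Bochner_measurable M f"
  shows "(\<lambda>x. norm (f x)) \<in> borel_measurable M"
proof -
  obtain s where s: "\<And>i::nat. simple_integrable M (s i)" "AE x in M. (\<lambda>i. s i x) \<longlonglongrightarrow> f x"
    using assms unfolding Bochner_measurable_def by blast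
  have [measurable]: "(\<lambda>x. norm (s i x)) \<in> borel_measurable M" for i
    by (rule simple_integrable_norm_measurable[OF s(1)])
  \<comment> \<open>The approximants converge only almost everywhere, so the norm merely agrees
    almost everywhere with a measurable function. Completeness of the measure turns this into
    measurability.\<close>
  have "AE x in M. norm (f x) = lim (\<lambda>i. norm (s i x))"
    using s(2) by eventually_elim (auto intro!: limI[symmetric] tendsto_norm)
  then show ?thesis
    by (rule borel_measurable_cong_AE) measurable
qed

text \<open>Truncating the approximating sequence at twice the norm of the limit makes it dominated.\<close>

lemma (in complete_measure) simple_integrable_dense:
  fixes f :: "'a \<Rightarrow> 'b::real_normed_vector" and p :: real
  assumes f: "Bochner_measurable M f" and p: "0 < p"
    and fin: "(\<integral>\<^sup>+x. ennreal (norm (f x) powr p) \<partial>M) < \<infinity>"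
  obtains s where "\<And>i::nat. simple_integrable M (s i)"
    "(\<lambda>i. \<integral>\<^sup>+x. ennreal (norm (f x - s i x) powr p) \<partial>M) \<longlonglongrightarrow> 0"
proof -
  obtain s where s: "\<And>i::nat. simple_integrable M (s i)" "AE x in M. (\<lambda>i. s i x) \<longlonglongrightarrow> f x"
    using f unfolding Bochner_measurable_def by blast
  define t where "t i x = (if norm (s i x) \<le> 2 * norm (f x) then s i x else 0)" for i x
  have [measurable]: "(\<lambda>x. norm (s i x)) \<in> borel_measurable M" for i
    by (rule simple_integrable_norm_measurable[OF s(1)])
  have [measurable]: "(\<lambda>x. norm (f x)) \<in> borel_measurable M"
    by (rule Bochner_measurable_norm[OF f])
  have t: "simple_integrable M (t i)" for i
  proof (rule simple_integrable_subset[OF s(1)[of i]])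
    have "simple_function M (s i)" using s(1) by (rule Bochner_Integration.simple_bochner_integrable.cases) assumption
    then show "simple_function M (t i)"
      unfolding t_def by (intro simple_function_If simple_function_const) measurable
  qed (auto simp: t_def split: if_splits)
  have [measurable]: "(\<lambda>x. norm (f x - t i x)) \<in> borel_measurable M" for i
    by (intro Bochner_measurable_norm Bochner_measurable_diff f Bochner_measurable_simple t)
  have tf: "AE x in M. (\<lambda>i. t i x) \<longlonglongrightarrow> f x"
    using s(2)
  proof eventually_elim
    case (elim x)
    show ?case
    \<comment> \<open>Where \<open>f x = 0\<close>, the strict inequality
      \<open>norm (f x) < 2 * norm (f x)\<close> fails, but there the truncation forces
      \<open>t i x = 0\<close>.\<close>
    proof (cases "f x = 0")
      case True
      then have "t i x = 0" for i by (auto simp: t_def)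
      then show ?thesis using True by simp
    next
      case False
      then have "norm (f x) < 2 * norm (f x)" by simp
      then have "\<forall>\<^sub>F i in sequentially. norm (s i x) < 2 * norm (f x)"
        using tendsto_norm[OF elim] by (rule order_tendstoD(2)[rotated])
      then have "\<forall>\<^sub>F i in sequentially. s i x = t i x"
        by eventually_elim (simp add: t_def)
      with elim show ?thesis by (rule Lim_transform_eventually)
    qed
  qed
  have "(\<lambda>i. \<integral>\<^sup>+x. ennreal (norm (f x - t i x) powr p) \<partial>M) \<longlonglongrightarrow> (\<integral>\<^sup>+x. 0 \<partial>M)"
  proof (rule nn_integral_dominated_convergence[where w="\<lambda>x. ennreal (3 powr p) * ennreal (norm (f x) powr p)"])
    show "AE x in M. ennreal (norm (f x - t i x) powr p) \<le> ennreal (3 powr p) * ennreal (norm (f x) powr p)" for i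
    proof (intro AE_I2)
      fix x
      have "norm (f x - t i x) \<le> norm (f x) + norm (t i x)" by (rule norm_triangle_ineq4)
      also have "\<dots> \<le> 3 * norm (f x)" by (simp add: t_def)
      finally have "norm (f x - t i x) powr p \<le> (3 * norm (f x)) powr p"
        using p by (intro powr_mono2) auto
      then show "ennreal (norm (f x - t i x) powr p) \<le> ennreal (3 powr p) * ennreal (norm (f x) powr p)"
        by (simp add: powr_mult ennreal_mult[symmetric] ennreal_leI)
    qed
    show "(\<integral>\<^sup>+x. ennreal (3 powr p) * ennreal (norm (f x) powr p) \<partial>M) < \<infinity>"
      using fin by (simp add: nn_integral_cmult ennreal_mult_less_top)
    show "AE x in M. (\<lambda>i. ennreal (norm (f x - t i x) powr p)) \<longlonglongrightarrow> 0"
      using tf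
    proof eventually_elim
      case (elim x)
      have "(\<lambda>i. norm (f x - t i x) powr p) \<longlonglongrightarrow> 0 powr p"
        using tendsto_norm[OF tendsto_diff[OF tendsto_const elim, of "f x"]] p
        by (intro tendsto_powr2) auto
      then show ?case using p by (simp flip: ennreal_0 add: tendsto_ennrealI)
    qed
  qed auto
  then have "(\<lambda>i. \<integral>\<^sup>+x. ennreal (norm (f x - t i x) powr p) \<partial>M) \<longlonglongrightarrow> 0" by simp
  with t show ?thesis by (rule that)
qed

section \<open>Existence, norm bound and linearity of the Bochner integral\<close>

lemma simple_integral_norm_le:
  assumes s: "simple_integrable M s"
  shows "ennreal (norm (simple_integral M s)) \<le> (\<integral>\<^sup>+x. norm (s x) \<partial>M)"
proof -
  have n: "simple_integrable M (\<lambda>x. norm (s x))"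
    using simple_bochner_integrable_compose2[of "\<lambda>x _. norm x" M s s] s by simp
  have "ennreal (norm (simple_integral M s)) \<le> ennreal (simple_integral M (\<lambda>x. norm (s x)))"
    by (intro ennreal_leI simple_bochner_integral_norm_bound s)
  also have "\<dots> = (\<integral>\<^sup>+x. norm (s x) \<partial>M)"
    using n by (rule simple_bochner_integral_eq_nn_integral) simp
  finally show ?thesis .
qed

lemma (in complete_measure) Bochner_measurable_diff_norm:
  assumes "Bochner_measurable M f" "simple_integrable M s"
  shows "(\<lambda>x. norm (f x - s x)) \<in> borel_measurable M"
  by (intro Bochner_measurable_norm Bochner_measurable_diff Bochner_measurable_simple assms)

text \<open>Density with exponent 1 gives simple functions whose integrals form a Cauchy sequence,
  because the distance of two integrals is at most the sum of the two errors. Completeness of the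
  codomain supplies the value.\<close>

lemma (in complete_measure) Bochner_integrableI_bounded:
  fixes f :: "'a \<Rightarrow> 'b::banach"
  assumes f: "Bochner_measurable M f" and fin: "(\<integral>\<^sup>+x. ennreal (norm (f x)) \<partial>M) < \<infinity>"
  shows "Bochner_integrable M f"
proof -
  have "(\<integral>\<^sup>+x. ennreal (norm (f x) powr 1) \<partial>M) < \<infinity>" using fin by simp
  from simple_integrable_dense[OF f zero_less_one this]
  obtain s where s: "\<And>i::nat. simple_integrable M (s i)"
    and lim: "(\<lambda>i. \<integral>\<^sup>+x. ennreal (norm (f x - s i x)) \<partial>M) \<longlonglongrightarrow> 0" by auto
  note [measurable] = Bochner_measurable_diff_norm[OF f s]
  let ?e = "\<lambda>i. \<integral>\<^sup>+x. ennreal (norm (f x - s i x)) \<partial>M"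
  have le: "ennreal (norm (simple_integral M (s m) - simple_integral M (s n))) \<le> ?e m + ?e n" for m n
  proof -
    have d: "simple_integrable M (\<lambda>x. s m x - s n x)"
      by (rule simple_bochner_integrable_compose2[OF _ s s]) simp
    have "ennreal (norm (simple_integral M (s m) - simple_integral M (s n)))
        = ennreal (norm (simple_integral M (\<lambda>x. s m x - s n x)))"
      by (subst simple_bochner_integral_diff[OF s s]) simp
    also have "\<dots> \<le> (\<integral>\<^sup>+x. norm (s m x - s n x) \<partial>M)"
      by (rule simple_integral_norm_le[OF d])
    also have "\<dots> \<le> (\<integral>\<^sup>+x. ennreal (norm (f x - s m x)) + ennreal (norm (f x - s n x)) \<partial>M)"
    proof (rule nn_integral_mono)
      fix x
      have "norm (s m x - s n x) \<le> norm (f x - s m x) + norm (f x - s n x)"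
        by (metis dual_order.refl norm_diff_triangle_le norm_minus_commute)
      then show "ennreal (norm (s m x - s n x)) \<le> ennreal (norm (f x - s m x)) + ennreal (norm (f x - s n x))"
        by (simp add: ennreal_plus[symmetric] ennreal_leI del: ennreal_plus)
    qed
    also have "\<dots> = ?e m + ?e n" by (rule nn_integral_add) measurable
    finally show ?thesis .
  qed
  have "Cauchy (\<lambda>i. simple_integral M (s i))"
  proof (rule metric_CauchyI)
    fix \<epsilon> :: real assume \<epsilon>: "0 < \<epsilon>"
    then have "\<forall>\<^sub>F i in sequentially. ?e i < ennreal (\<epsilon> / 2)"
      using lim by (intro order_tendstoD(2)) auto
    then obtain N where N: "\<And>i. N \<le> i \<Longrightarrow> ?e i < ennreal (\<epsilon> / 2)"
      by (auto simp: eventually_sequentially)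
    have "dist (simple_integral M (s m)) (simple_integral M (s n)) < \<epsilon>" if "N \<le> m" "N \<le> n" for m n
    proof -
      have "?e m + ?e n < ennreal (\<epsilon> / 2) + ennreal (\<epsilon> / 2)"
        using N that by (intro add_strict_mono) auto
      also have "\<dots> = ennreal \<epsilon>" using \<epsilon> by (subst ennreal_plus[symmetric]) auto
      finally have "ennreal (norm (simple_integral M (s m) - simple_integral M (s n))) < ennreal \<epsilon>"
        using le[of m n] by simp
      then show ?thesis by (simp add: dist_norm ennreal_less_iff)
    qed
    then show "\<exists>N. \<forall>m\<ge>N. \<forall>n\<ge>N. dist (simple_integral M (s m)) (simple_integral M (s n)) < \<epsilon>" by blast
  qed
  then obtain y where "(\<lambda>i. simple_integral M (s i)) \<longlonglongrightarrow> y"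
    unfolding Cauchy_convergent_iff convergent_def by blast
  with f s lim show ?thesis
    unfolding Bochner_integrable_def has_Bochner_integral_def by blast
qed

lemma (in complete_measure) has_Bochner_integral_norm_le:
  assumes "has_Bochner_integral M f y"
  shows "ennreal (norm y) \<le> (\<integral>\<^sup>+x. ennreal (norm (f x)) \<partial>M)"
proof -
  obtain s where f: "Bochner_measurable M f" and s: "\<And>i::nat. simple_integrable M (s i)"
    and lim: "(\<lambda>i. \<integral>\<^sup>+x. ennreal (norm (f x - s i x)) \<partial>M) \<longlonglongrightarrow> 0"
    and y: "(\<lambda>i. simple_integral M (s i)) \<longlonglongrightarrow> y"
    using assms unfolding has_Bochner_integral_def by blast
  note [measurable] = Bochner_measurable_diff_norm[OF f s] Bochner_measurable_norm[OF f]
  have "ennreal (norm (simple_integral M (s i)))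
      \<le> (\<integral>\<^sup>+x. ennreal (norm (f x)) \<partial>M) + (\<integral>\<^sup>+x. ennreal (norm (f x - s i x)) \<partial>M)" for i
  proof -
    have "ennreal (norm (simple_integral M (s i))) \<le> (\<integral>\<^sup>+x. norm (s i x) \<partial>M)"
      by (rule simple_integral_norm_le[OF s])
    also have "\<dots> \<le> (\<integral>\<^sup>+x. ennreal (norm (f x)) + ennreal (norm (f x - s i x)) \<partial>M)"
    proof (rule nn_integral_mono)
      fix x
      have "norm (s i x) \<le> norm (f x) + norm (f x - s i x)"
        using norm_triangle_ineq4[of "f x" "f x - s i x"] by simp
      then show "ennreal (norm (s i x)) \<le> ennreal (norm (f x)) + ennreal (norm (f x - s i x))"
        by (simp add: ennreal_plus[symmetric] ennreal_leI del: ennreal_plus)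
    qed
    also have "\<dots> = (\<integral>\<^sup>+x. ennreal (norm (f x)) \<partial>M) + (\<integral>\<^sup>+x. ennreal (norm (f x - s i x)) \<partial>M)"
      by (rule nn_integral_add) measurable
    finally show ?thesis .
  qed
  then have "\<exists>N. \<forall>i\<ge>N. ennreal (norm (simple_integral M (s i)))
      \<le> (\<integral>\<^sup>+x. ennreal (norm (f x)) \<partial>M) + (\<integral>\<^sup>+x. ennreal (norm (f x - s i x)) \<partial>M)"
    by blast
  moreover have "(\<lambda>i. ennreal (norm (simple_integral M (s i)))) \<longlonglongrightarrow> ennreal (norm y)"
    by (intro tendsto_intros y)
  moreover have "(\<lambda>i. (\<integral>\<^sup>+x. ennreal (norm (f x)) \<partial>M) + (\<integral>\<^sup>+x. ennreal (norm (f x - s i x)) \<partial>M))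
      \<longlonglongrightarrow> (\<integral>\<^sup>+x. ennreal (norm (f x)) \<partial>M) + 0"
    by (intro tendsto_add tendsto_const lim)
  ultimately have "ennreal (norm y) \<le> (\<integral>\<^sup>+x. ennreal (norm (f x)) \<partial>M) + 0"
    by (rule LIMSEQ_le[rotated 2])
  then show ?thesis by simp
qed

lemma has_Bochner_integral_cong_AE:
  assumes eq: "AE x in M. f x = g x" and "has_Bochner_integral M f y"
  shows "has_Bochner_integral M g y"
proof -
  obtain s where f: "Bochner_measurable M f" and s: "\<And>i::nat. simple_integrable M (s i)"
    and lim: "(\<lambda>i. \<integral>\<^sup>+x. ennreal (norm (f x - s i x)) \<partial>M) \<longlonglongrightarrow> 0"
    and y: "(\<lambda>i. simple_integral M (s i)) \<longlonglongrightarrow> y"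
    using assms unfolding has_Bochner_integral_def by blast
  have "(\<integral>\<^sup>+x. ennreal (norm (f x - s i x)) \<partial>M) = (\<integral>\<^sup>+x. ennreal (norm (g x - s i x)) \<partial>M)" for i
    by (rule nn_integral_cong_AE) (use eq in eventually_elim, simp)
  with lim have "(\<lambda>i. \<integral>\<^sup>+x. ennreal (norm (g x - s i x)) \<partial>M) \<longlonglongrightarrow> 0" by simp
  with s y Bochner_measurable_cong_AE[OF eq f] show ?thesis
    unfolding has_Bochner_integral_def by blast
qed

lemma Bochner_integral_cong_AE:
  assumes eq: "AE x in M. f x = g x"
  shows "Bochner_integral M f = Bochner_integral M g"
proof -
  have "AE x in M. g x = f x" using eq by eventually_elim simp
  then have "has_Bochner_integral M f y \<longleftrightarrow> has_Bochner_integral M g y" for y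
    using has_Bochner_integral_cong_AE eq by blast
  then have "has_Bochner_integral M f = has_Bochner_integral M g" by (rule ext)
  then show ?thesis by (simp add: Bochner_integral_def Bochner_integrable_def)
qed

lemma has_Bochner_integral_integral:
  "Bochner_integrable M f \<Longrightarrow> has_Bochner_integral M f (Bochner_integral M f)"
  unfolding Bochner_integrable_def using Bochner_integral_eqI by metis

lemma (in complete_measure) has_Bochner_integral_add:
  assumes "has_Bochner_integral M f y" "has_Bochner_integral M g z"
  shows "has_Bochner_integral M (\<lambda>x. f x + g x) (y + z)"
proof -
  obtain s where f: "Bochner_measurable M f" and s: "\<And>i::nat. simple_integrable M (s i)"
    and slim: "(\<lambda>i. \<integral>\<^sup>+x. ennreal (norm (f x - s i x)) \<partial>M) \<longlonglongrightarrow> 0"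
    and y: "(\<lambda>i. simple_integral M (s i)) \<longlonglongrightarrow> y"
    using assms unfolding has_Bochner_integral_def by blast
  obtain t where g: "Bochner_measurable M g" and t: "\<And>i::nat. simple_integrable M (t i)"
    and tlim: "(\<lambda>i. \<integral>\<^sup>+x. ennreal (norm (g x - t i x)) \<partial>M) \<longlonglongrightarrow> 0"
    and z: "(\<lambda>i. simple_integral M (t i)) \<longlonglongrightarrow> z"
    using assms unfolding has_Bochner_integral_def by blast
  note [measurable] = Bochner_measurable_diff_norm[OF f s] Bochner_measurable_diff_norm[OF g t]
  let ?e = "\<lambda>i. \<integral>\<^sup>+x. ennreal (norm (f x + g x - (s i x + t i x))) \<partial>M"
  have "?e i \<le> (\<integral>\<^sup>+x. ennreal (norm (f x - s i x)) \<partial>M) + (\<integral>\<^sup>+x. ennreal (norm (g x - t i x)) \<partial>M)" for i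
  proof -
    have "?e i \<le> (\<integral>\<^sup>+x. ennreal (norm (f x - s i x)) + ennreal (norm (g x - t i x)) \<partial>M)"
      by (intro nn_integral_mono)
        (simp add: ennreal_plus[symmetric] ennreal_leI norm_diff_triangle_ineq del: ennreal_plus)
    then show ?thesis by (simp add: nn_integral_add)
  qed
  moreover have "(\<lambda>i. (\<integral>\<^sup>+x. ennreal (norm (f x - s i x)) \<partial>M) + (\<integral>\<^sup>+x. ennreal (norm (g x - t i x)) \<partial>M)) \<longlonglongrightarrow> 0"
    using tendsto_add[OF slim tlim] by simp
  ultimately have "?e \<longlonglongrightarrow> 0"
    by (intro tendsto_sandwich[OF _ _ tendsto_const, of 0 ?e]) simp_all
  moreover have "simple_integrable M (\<lambda>x. s i x + t i x)" for i
    by (rule simple_bochner_integrable_compose2[OF _ s t]) simp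
  moreover have "(\<lambda>i. simple_integral M (\<lambda>x. s i x + t i x)) \<longlonglongrightarrow> y + z"
    using tendsto_add[OF y z] by (simp add: simple_bochner_integral_add[OF s t])
  ultimately show ?thesis
    unfolding has_Bochner_integral_def using Bochner_measurable_add[OF f g]
    by (intro conjI exI[of _ "\<lambda>i x. s i x + t i x"]) auto
qed

text \<open>The change of codomain matters: with \<open>T r = r *\<^sub>R y\<close> a scalar
  integral becomes an integral with values in the Banach space.\<close>

lemma (in complete_measure) has_Bochner_integral_linear:
  fixes T :: "'b::real_normed_vector \<Rightarrow> 'c::real_normed_vector"
  assumes T: "bounded_linear T" and "has_Bochner_integral M f y"
  shows "has_Bochner_integral M (\<lambda>x. T (f x)) (T y)"
proof -
  interpret T: bounded_linear T by fact
  obtain s where f: "Bochner_measurable M f" and s: "\<And>i::nat. simple_integrable M (s i)"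
    and slim: "(\<lambda>i. \<integral>\<^sup>+x. ennreal (norm (f x - s i x)) \<partial>M) \<longlonglongrightarrow> 0"
    and y: "(\<lambda>i. simple_integral M (s i)) \<longlonglongrightarrow> y"
    using assms unfolding has_Bochner_integral_def by blast
  note [measurable] = Bochner_measurable_diff_norm[OF f s]
  obtain K where K: "0 \<le> K" "\<And>x. norm (T x) \<le> norm x * K" using T.nonneg_bounded by blast
  let ?e = "\<lambda>i. \<integral>\<^sup>+x. ennreal (norm (T (f x) - T (s i x))) \<partial>M"
  have "?e i \<le> ennreal K * (\<integral>\<^sup>+x. ennreal (norm (f x - s i x)) \<partial>M)" for i
  proof -
    have "?e i \<le> (\<integral>\<^sup>+x. ennreal K * ennreal (norm (f x - s i x)) \<partial>M)"
      using K by (intro nn_integral_mono)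
        (simp add: ennreal_mult[symmetric] ennreal_leI mult.commute flip: T.diff)
    then show ?thesis by (simp add: nn_integral_cmult)
  qed
  moreover have "(\<lambda>i. ennreal K * (\<integral>\<^sup>+x. ennreal (norm (f x - s i x)) \<partial>M)) \<longlonglongrightarrow> 0"
    using ennreal_tendsto_cmult[OF _ slim, of "ennreal K"] by simp
  ultimately have "?e \<longlonglongrightarrow> 0"
    by (intro tendsto_sandwich[OF _ _ tendsto_const, of 0 ?e]) simp_all
  moreover have "simple_integrable M (\<lambda>x. T (s i x))" for i
    using simple_bochner_integrable_compose2[of "\<lambda>x _. T x", OF _ s s] by (simp add: T.zero)
  moreover have "(\<lambda>i. simple_integral M (\<lambda>x. T (s i x))) \<longlonglongrightarrow> T y"
    using T.tendsto[OF y] by (simp add: simple_bochner_integral_linear[OF T.linear_axioms s])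
  ultimately show ?thesis
    unfolding has_Bochner_integral_def using Bochner_measurable_linear[OF T f]
    by (intro conjI exI[of _ "\<lambda>i x. T (s i x)"]) auto
qed

section \<open>Integrals of powers and almost everywhere convergence\<close>

lemma simple_integrable_powr_finite:
  assumes s: "simple_integrable M s" and p: "0 < p"
  shows "(\<integral>\<^sup>+x. ennreal (norm (s x) powr p) \<partial>M) < \<infinity>"
proof -
  have "simple_integrable M (\<lambda>x. norm (s x) powr p)"
    using simple_bochner_integrable_compose2[of "\<lambda>x _. norm x powr p", OF _ s s] p by simp
  then have "ennreal (simple_integral M (\<lambda>x. norm (s x) powr p)) = (\<integral>\<^sup>+x. ennreal (norm (s x) powr p) \<partial>M)"
    by (rule simple_bochner_integral_eq_nn_integral) simp
  then show ?thesis by (metis ennreal_less_top infinity_ennreal_def)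
qed

text \<open>The sum of the powers has a finite integral, hence is finite almost everywhere, and the
  terms of a convergent series tend to 0. With errors this small, the whole sequence converges and
  no subsequence has to be chosen.\<close>

lemma AE_tendsto_zero_of_summable_powr:
  fixes u :: "nat \<Rightarrow> 'a \<Rightarrow> real"
  assumes [measurable]: "\<And>n. u n \<in> borel_measurable M" and u0: "\<And>n x. 0 \<le> u n x" and q: "0 < q"
    and le: "\<And>n. (\<integral>\<^sup>+x. ennreal (u n x powr q) \<partial>M) \<le> ennreal ((1 / 2) ^ n)"
  shows "AE x in M. (\<lambda>n. u n x) \<longlonglongrightarrow> 0"
proof -
  have "(\<integral>\<^sup>+x. (\<Sum>n. ennreal (u n x powr q)) \<partial>M) = (\<Sum>n. \<integral>\<^sup>+x. ennreal (u n x powr q) \<partial>M)"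
    by (rule nn_integral_suminf) measurable
  also have "\<dots> \<le> (\<Sum>n. ennreal ((1 / 2) ^ n))"
    by (intro suminf_le le) auto
  also have "\<dots> = ennreal (\<Sum>n. (1 / 2) ^ n)"
    by (intro suminf_ennreal2) (auto simp: summable_geometric)
  also have "\<dots> < \<infinity>" by simp
  finally have "AE x in M. (\<Sum>n. ennreal (u n x powr q)) \<noteq> \<infinity>"
    by (intro nn_integral_noteq_infinite) auto
  then show ?thesis
  proof eventually_elim
    case (elim x)
    then have "summable (\<lambda>n. u n x powr q)"
      by (intro summable_suminf_not_top) auto
    then have "(\<lambda>n. (u n x powr q) powr (1 / q)) \<longlonglongrightarrow> 0 powr (1 / q)"
      using q by (intro tendsto_powr2 summable_LIMSEQ_zero tendsto_const) auto
    then show ?case using q u0 by (simp add: powr_powr)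
  qed
qed

lemma sigma_finite_completion:
  assumes "sigma_finite_measure M"
  shows "sigma_finite_measure (completion M)"
proof
  obtain A where "countable A" "A \<subseteq> sets M" "\<Union>A = space M" "\<forall>a\<in>A. emeasure M a \<noteq> \<infinity>"
    using sigma_finite_measure.sigma_finite_countable[OF assms] by blast
  then show "\<exists>A. countable A \<and> A \<subseteq> sets (completion M) \<and> \<Union>A = space (completion M)
      \<and> (\<forall>a\<in>A. emeasure (completion M) a \<noteq> \<infinity>)"
    by (intro exI[of _ A]) (auto simp: subset_eq)
qed

section \<open>The Riemann-Liouville integral on an interval\<close>

locale RL_interval =
  fixes \<alpha> t0 :: real and I :: "real set"
  assumes \<alpha>: "0 < \<alpha>" and I: "(\<exists>t1\<ge>t0. I = {t0..t1}) \<or> I = {t0..}"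
begin

text \<open>Extension by zero turns integrals over \<open>{t0..t}\<close>, whose domain moves with
  \<open>t\<close>, into one convolution on the line.\<close>

abbreviation majorant :: "(real \<Rightarrow> 'x::real_normed_vector) \<Rightarrow> real \<Rightarrow> ennreal" where
  "majorant f \<equiv> frac_conv \<alpha> (\<lambda>s. indicator I s * norm (f s))"

lemma I_borel [measurable]: "I \<in> sets borel"
  using I by auto

lemma I_lebesgue: "I \<in> sets lebesgue"
  using I_borel by simp

lemma I_subset: "t \<in> I \<Longrightarrow> {t0..t} \<subseteq> I"
  using I by auto

sublocale M: complete_measure "lebesgue_on I"
  by (rule complete_measure_lebesgue_on[OF I_lebesgue])

lemma sigma_finite_lebesgue_on: "S \<in> sets lebesgue \<Longrightarrow> sigma_finite_measure (lebesgue_on S)"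
  by (intro sigma_finite_measure_restrict_space sigma_finite_completion sigma_finite_lborel)

lemma lebesgue_on_subinterval:
  "{t0..T} \<subseteq> I \<Longrightarrow> lebesgue_on {t0..T} = restrict_space (lebesgue_on I) {t0..T}"
  using I_lebesgue by (subst restrict_restrict_space) (auto simp: Int_absorb1)

lemma Bochner_measurable_subinterval:
  assumes "{t0..T} \<subseteq> I" "Bochner_measurable (lebesgue_on I) f"
  shows "Bochner_measurable (lebesgue_on {t0..T}) f"
  unfolding lebesgue_on_subinterval[OF assms(1)]
  using assms I_lebesgue
  by (intro Bochner_measurable_restrict_space[OF _ assms(2)]) (auto simp: sets_restrict_space_iff)

lemma AE_subinterval:
  assumes "{t0..T} \<subseteq> I" "AE x in lebesgue_on I. P x"
  shows "AE x in lebesgue_on {t0..T}. P x"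
  using assms I_lebesgue by (subst AE_restrict_space_iff, simp) (subst (asm) AE_restrict_space_iff, simp, auto elim!: eventually_mono)

lemma nn_integral_subinterval_le:
  assumes "{t0..T} \<subseteq> I"
  shows "(\<integral>\<^sup>+x. F x \<partial>lebesgue_on {t0..T}) \<le> (\<integral>\<^sup>+x. F x \<partial>lebesgue_on I)"
  using assms I_lebesgue
  by (auto simp: nn_integral_restrict_space indicator_def intro!: nn_integral_mono)

lemma norm_extension_measurable:
  assumes "Bochner_measurable (lebesgue_on I) f"
  shows "(\<lambda>s. indicator I s * norm (f s)) \<in> borel_measurable lebesgue"
  using M.Bochner_measurable_norm[OF assms] I_lebesgue
  by (simp add: borel_measurable_restrict_space_iff)

lemma majorant_measurable [measurable (raw)]:
  assumes "Bochner_measurable (lebesgue_on I) f"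
  shows "majorant f \<in> borel_measurable borel"
  by (intro frac_conv_lebesgue_measurable norm_extension_measurable assms) auto

lemma enn2real_majorant_measurable:
  assumes "Bochner_measurable (lebesgue_on I) f"
  shows "(\<lambda>t. enn2real (majorant f t)) \<in> borel_measurable (lebesgue_on I)"
proof -
  note [measurable] = majorant_measurable[OF assms]
  show ?thesis by (intro measurable_restrict_space1 measurable_completion) measurable
qed

text \<open>The one-sided kernel removes \<open>s > t\<close> and the zero extension removes
  \<open>s < t0\<close>. At \<open>s = t\<close> both sides are 0, since
  \<open>0 powr (\<alpha> - 1)\<close> is 0 by convention.\<close>

lemma nn_integral_RL_integrand:
  assumes t: "t \<in> I"
  shows "(\<integral>\<^sup>+s. ennreal (norm (RL_integrand \<alpha> t f s)) \<partial>lebesgue_on {t0..t}) = majorant f t"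
proof -
  have "(\<integral>\<^sup>+s. ennreal (norm (RL_integrand \<alpha> t f s)) \<partial>lebesgue_on {t0..t})
      = (\<integral>\<^sup>+s. ennreal (norm (RL_integrand \<alpha> t f s)) * indicator {t0..t} s \<partial>lborel)"
    by (simp add: nn_integral_restrict_space nn_integral_completion)
  also have "\<dots> = majorant f t"
    unfolding frac_conv_def
  proof (rule nn_integral_cong)
    fix s
    have "s \<in> I" if "t0 \<le> s" "s \<le> t" using I_subset[OF t] that by auto
    moreover have "t0 \<le> s" if "s \<in> I" using I that by auto
    ultimately show "ennreal (norm (RL_integrand \<alpha> t f s)) * indicator {t0..t} s
        = ennreal (pos_power \<alpha> (t - s) * (indicator I s * norm (f s)))"
      by (auto simp: RL_integrand_def pos_power_def indicator_def)
  qed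
  finally show ?thesis .
qed

section \<open>Existence, norm bound and linearity of the fractional integral at a point\<close>

lemma RL_integrand_Bochner_measurable:
  assumes t: "t \<in> I" and f: "Bochner_measurable (lebesgue_on I) f"
  shows "Bochner_measurable (lebesgue_on {t0..t}) (RL_integrand \<alpha> t f)"
proof -
  have "(\<lambda>s. (t - s) powr (\<alpha> - 1)) \<in> borel_measurable (lebesgue_on {t0..t})"
    by (intro measurable_restrict_space1 measurable_completion) measurable
  then have "Bochner_measurable (lebesgue_on {t0..t}) (\<lambda>s. (t - s) powr (\<alpha> - 1))"
    by (intro Bochner_measurable_borel sigma_finite_lebesgue_on) auto
  with Bochner_measurable_subinterval[OF I_subset[OF t] f] show ?thesis
    unfolding RL_integrand_def by (rule Bochner_measurable_scaleR[rotated])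
qed

lemma RL_exists_atI:
  fixes f :: "real \<Rightarrow> 'x::banach"
  assumes "t \<in> I" "Bochner_measurable (lebesgue_on I) f" "majorant f t < \<infinity>"
  shows "RL_exists_at \<alpha> t0 f t"
  unfolding RL_exists_at_def
proof (rule complete_measure.Bochner_integrableI_bounded)
  show "complete_measure (lebesgue_on {t0..t})" by (rule complete_measure_lebesgue_on) simp
qed (use assms in \<open>simp_all only: RL_integrand_Bochner_measurable nn_integral_RL_integrand\<close>)

lemma norm_RL_integral_le:
  fixes f :: "real \<Rightarrow> 'x::banach"
  assumes t: "t \<in> I" and fin: "majorant f t < \<infinity>"
  shows "norm (RL_integral \<alpha> t0 f t) \<le> enn2real (majorant f t) / Gamma \<alpha>"
proof -
  let ?y = "Bochner_integral (lebesgue_on {t0..t}) (RL_integrand \<alpha> t f)"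
  have "norm ?y \<le> enn2real (majorant f t)"
  \<comment> \<open>If the integral does not exist, its default value 0 satisfies the bound
    trivially.\<close>
  proof (cases "RL_exists_at \<alpha> t0 f t")
    case True
    then have "has_Bochner_integral (lebesgue_on {t0..t}) (RL_integrand \<alpha> t f) ?y"
      unfolding RL_exists_at_def by (rule has_Bochner_integral_integral)
    then have "ennreal (norm ?y) \<le> majorant f t"
      unfolding nn_integral_RL_integrand[OF t, symmetric]
      by (intro complete_measure.has_Bochner_integral_norm_le complete_measure_lebesgue_on) auto
    then show ?thesis
      using fin enn2real_mono[of "ennreal (norm ?y)" "majorant f t"] by simp
  qed (simp add: RL_exists_at_def Bochner_integral_def)
  then show ?thesis
    using Gamma_real_pos[OF \<alpha>] by (simp add: RL_integral_def divide_right_mono)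
qed

lemma RL_integral_add:
  assumes "RL_exists_at \<alpha> t0 f t" "RL_exists_at \<alpha> t0 g t"
  shows "RL_exists_at \<alpha> t0 (\<lambda>s. f s + g s) t"
    and "RL_integral \<alpha> t0 (\<lambda>s. f s + g s) t = RL_integral \<alpha> t0 f t + RL_integral \<alpha> t0 g t"
proof -
  interpret S: complete_measure "lebesgue_on {t0..t}" by (rule complete_measure_lebesgue_on) simp
  have "has_Bochner_integral (lebesgue_on {t0..t}) (\<lambda>s. RL_integrand \<alpha> t f s + RL_integrand \<alpha> t g s)
     (Bochner_integral (lebesgue_on {t0..t}) (RL_integrand \<alpha> t f) + Bochner_integral (lebesgue_on {t0..t}) (RL_integrand \<alpha> t g))"
    using assms unfolding RL_exists_at_def
    by (intro S.has_Bochner_integral_add has_Bochner_integral_integral)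
  then have *: "has_Bochner_integral (lebesgue_on {t0..t}) (RL_integrand \<alpha> t (\<lambda>s. f s + g s))
     (Bochner_integral (lebesgue_on {t0..t}) (RL_integrand \<alpha> t f) + Bochner_integral (lebesgue_on {t0..t}) (RL_integrand \<alpha> t g))"
    by (simp add: RL_integrand_def[abs_def] scaleR_right_distrib)
  then show "RL_exists_at \<alpha> t0 (\<lambda>s. f s + g s) t"
    unfolding RL_exists_at_def Bochner_integrable_def by blast
  show "RL_integral \<alpha> t0 (\<lambda>s. f s + g s) t = RL_integral \<alpha> t0 f t + RL_integral \<alpha> t0 g t"
    unfolding RL_integral_def Bochner_integral_eqI[OF *] by (rule scaleR_right_distrib)
qed

lemma RL_integral_scaleR:
  assumes "RL_exists_at \<alpha> t0 f t"
  shows "RL_exists_at \<alpha> t0 (\<lambda>s. c *\<^sub>R f s) t"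
    and "RL_integral \<alpha> t0 (\<lambda>s. c *\<^sub>R f s) t = c *\<^sub>R RL_integral \<alpha> t0 f t"
proof -
  interpret S: complete_measure "lebesgue_on {t0..t}" by (rule complete_measure_lebesgue_on) simp
  have "has_Bochner_integral (lebesgue_on {t0..t}) (\<lambda>s. c *\<^sub>R RL_integrand \<alpha> t f s)
     (c *\<^sub>R Bochner_integral (lebesgue_on {t0..t}) (RL_integrand \<alpha> t f))"
    using assms unfolding RL_exists_at_def
    by (intro S.has_Bochner_integral_linear[OF bounded_linear_scaleR_right] has_Bochner_integral_integral)
  then have *: "has_Bochner_integral (lebesgue_on {t0..t}) (RL_integrand \<alpha> t (\<lambda>s. c *\<^sub>R f s))
     (c *\<^sub>R Bochner_integral (lebesgue_on {t0..t}) (RL_integrand \<alpha> t f))"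
    by (simp add: RL_integrand_def[abs_def] mult.commute)
  then show "RL_exists_at \<alpha> t0 (\<lambda>s. c *\<^sub>R f s) t"
    unfolding RL_exists_at_def Bochner_integrable_def by blast
  show "RL_integral \<alpha> t0 (\<lambda>s. c *\<^sub>R f s) t = c *\<^sub>R RL_integral \<alpha> t0 f t"
    unfolding RL_integral_def Bochner_integral_eqI[OF *] by (simp add: mult.commute)
qed

text \<open>A null set of \<open>s\<close> is invisible to the integral at each fixed
  \<open>t\<close>, so no exceptional \<open>t\<close> arises. This makes the operator well defined
  on classes.\<close>

lemma RL_integral_cong_AE:
  assumes t: "t \<in> I" and eq: "AE s in lebesgue_on I. f s = g s"
  shows "RL_integral \<alpha> t0 f t = RL_integral \<alpha> t0 g t"
proof -
  have "AE s in lebesgue_on {t0..t}. RL_integrand \<alpha> t f s = RL_integrand \<alpha> t g s"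
    using AE_subinterval[OF I_subset[OF t] eq] by eventually_elim (simp add: RL_integrand_def)
  then show ?thesis
    unfolding RL_integral_def by (simp add: Bochner_integral_cong_AE)
qed

section \<open>Strong measurability of the fractional integral of a simple function\<close>

lemma RL_integral_indicator:
  fixes y :: "'x::banach"
  assumes A: "A \<in> sets (lebesgue_on I)"
  shows "\<And>t. t \<in> I \<Longrightarrow> RL_exists_at \<alpha> t0 (\<lambda>s. indicator A s *\<^sub>R y) t"
    and "Bochner_measurable (lebesgue_on I) (RL_integral \<alpha> t0 (\<lambda>s. indicator A s *\<^sub>R y))"
proof -
  \<comment> \<open>The fractional integral of \<open>indicator A s *\<^sub>R y\<close> points in
    the fixed direction \<open>y\<close>. Its scalar coefficient is \<phi> up to the factor 1 /
    Gamma \<alpha>, so strong measurability reduces to the scalar case.\<close>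
  define \<phi> :: "real \<Rightarrow> real" where "\<phi> t = enn2real (majorant (indicat_real A) t)" for t
  have A_meas: "Bochner_measurable (lebesgue_on I) (indicat_real A)"
    using A by (intro Bochner_measurable_borel sigma_finite_lebesgue_on I_lebesgue borel_measurable_indicator)
  have has: "has_Bochner_integral (lebesgue_on {t0..t}) (RL_integrand \<alpha> t (\<lambda>s. indicator A s *\<^sub>R y)) (\<phi> t *\<^sub>R y)"
    if t: "t \<in> I" for t
  proof -
    interpret S: complete_measure "lebesgue_on {t0..t}" by (rule complete_measure_lebesgue_on) simp
    have t0: "t0 \<le> t" using I t by auto
    \<comment> \<open>\<open>A\<close> may have infinite measure, but the kernel has finite mass on
      \<open>{t0..t}\<close>. This gives existence at every \<open>t\<close> in
      \<open>I\<close>.\<close>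
    have "majorant (indicat_real A) t \<le> (\<integral>\<^sup>+s. ennreal (pos_power \<alpha> (t - s)) * indicator {..t - t0} (t - s) \<partial>lborel)"
      unfolding frac_conv_def
    proof (rule nn_integral_mono)
      fix s
      have "t0 \<le> s" if "s \<in> I" using I that by auto
      then show "ennreal (pos_power \<alpha> (t - s) * (indicator I s * norm (indicat_real A s)))
        \<le> ennreal (pos_power \<alpha> (t - s)) * indicator {..t - t0} (t - s)"
        by (auto simp: indicator_def)
    qed
    also have "\<dots> = (\<integral>\<^sup>+u. ennreal (pos_power \<alpha> u) * indicator {..t - t0} u \<partial>lborel)"
      by (rule nn_integral_reflect[where F="\<lambda>s. ennreal (pos_power \<alpha> s) * indicator {..t - t0} s"]) measurable
    also have "\<dots> < \<infinity>"
      using \<alpha> t0 by (simp add: nn_integral_pos_power)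
    finally have fin: "majorant (indicat_real A) t < \<infinity>" .
    have "RL_integrand \<alpha> t (indicat_real A) \<in> borel_measurable (lebesgue_on {t0..t})"
    proof -
      have "indicat_real A \<in> borel_measurable (lebesgue_on {t0..t})"
        unfolding lebesgue_on_subinterval[OF I_subset[OF t]]
        using A by (intro measurable_restrict_space1 borel_measurable_indicator)
      moreover have "(\<lambda>s. (t - s) powr (\<alpha> - 1)) \<in> borel_measurable (lebesgue_on {t0..t})"
        by (intro measurable_restrict_space1 measurable_completion) measurable
      ultimately show ?thesis
        unfolding RL_integrand_def by (intro borel_measurable_scaleR)
    qed
    moreover have "(\<integral>\<^sup>+s. ennreal (RL_integrand \<alpha> t (indicat_real A) s) \<partial>lebesgue_on {t0..t}) = ennreal (\<phi> t)"
    proof -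
      have "(\<integral>\<^sup>+s. ennreal (RL_integrand \<alpha> t (indicat_real A) s) \<partial>lebesgue_on {t0..t}) = majorant (indicat_real A) t"
        unfolding nn_integral_RL_integrand[OF t, symmetric]
        by (intro nn_integral_cong) (simp add: RL_integrand_def)
      then show ?thesis using fin by (simp add: \<phi>_def)
    qed
    ultimately have "has_bochner_integral (lebesgue_on {t0..t}) (RL_integrand \<alpha> t (indicat_real A)) (\<phi> t)"
      by (intro has_bochner_integral_nn_integral) (auto simp: \<phi>_def RL_integrand_def)
    then have "has_Bochner_integral (lebesgue_on {t0..t}) (\<lambda>s. RL_integrand \<alpha> t (indicat_real A) s *\<^sub>R y) (\<phi> t *\<^sub>R y)"
      by (intro S.has_Bochner_integral_linear[OF bounded_linear_scaleR_left] has_bochner_integral_imp_has_Bochner_integral)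
    then show ?thesis by (simp add: RL_integrand_def[abs_def])
  qed
  then show "RL_exists_at \<alpha> t0 (\<lambda>s. indicator A s *\<^sub>R y) t" if "t \<in> I" for t
    using that unfolding RL_exists_at_def Bochner_integrable_def by blast
  have "Bochner_measurable (lebesgue_on I) (\<lambda>t. \<phi> t / Gamma \<alpha>)"
    unfolding \<phi>_def using enn2real_majorant_measurable[OF A_meas]
    by (intro Bochner_measurable_borel sigma_finite_lebesgue_on I_lebesgue borel_measurable_divide) auto
  then have "Bochner_measurable (lebesgue_on I) (\<lambda>t. (\<phi> t / Gamma \<alpha>) *\<^sub>R y)"
    by (rule Bochner_measurable_linear[OF bounded_linear_scaleR_left])
  moreover have "AE t in lebesgue_on I. (\<phi> t / Gamma \<alpha>) *\<^sub>R y = RL_integral \<alpha> t0 (\<lambda>s. indicator A s *\<^sub>R y) t"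
    using Bochner_integral_eqI[OF has] by (intro AE_I2) (simp add: RL_integral_def)
  ultimately show "Bochner_measurable (lebesgue_on I) (RL_integral \<alpha> t0 (\<lambda>s. indicator A s *\<^sub>R y))"
    by (rule Bochner_measurable_cong_AE[rotated])
qed

text \<open>Existence is carried through the induction because additivity is available only at
  points where both integrals exist.\<close>

lemma RL_integral_step:
  fixes Y :: "'x::banach set"
  assumes "finite Y" and A: "\<And>y. y \<in> Y \<Longrightarrow> A y \<in> sets (lebesgue_on I)"
  shows "(\<forall>t\<in>I. RL_exists_at \<alpha> t0 (\<lambda>s. \<Sum>y\<in>Y. indicator (A y) s *\<^sub>R y) t) \<and>
    Bochner_measurable (lebesgue_on I) (RL_integral \<alpha> t0 (\<lambda>s. \<Sum>y\<in>Y. indicator (A y) s *\<^sub>R y))"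
  using assms
proof (induction Y rule: finite_induct)
  case empty
  have "RL_exists_at \<alpha> t0 (\<lambda>s. 0 :: 'x) t" if "t \<in> I" for t
    using RL_integral_indicator(1)[of "{}" t "0 :: 'x"] that by simp
  then show ?case using RL_integral_indicator(2)[of "{}" "0 :: 'x"] by simp
next
  case (insert z Y)
  let ?f = "\<lambda>s. indicator (A z) s *\<^sub>R z" and ?g = "\<lambda>s. \<Sum>y\<in>Y. indicator (A y) s *\<^sub>R y"
  have f: "\<And>t. t \<in> I \<Longrightarrow> RL_exists_at \<alpha> t0 ?f t" "Bochner_measurable (lebesgue_on I) (RL_integral \<alpha> t0 ?f)"
    using RL_integral_indicator[where A = "A z" and y = z] insert.prems by auto
  have g: "\<And>t. t \<in> I \<Longrightarrow> RL_exists_at \<alpha> t0 ?g t" "Bochner_measurable (lebesgue_on I) (RL_integral \<alpha> t0 ?g)"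
    using insert.IH insert.prems by (simp_all only: insert_iff simp_thms)
  have eq: "(\<lambda>s. \<Sum>y\<in>insert z Y. indicator (A y) s *\<^sub>R y) = (\<lambda>s. ?f s + ?g s)"
    using insert.hyps by (simp only: sum.insert not_False_eq_True)
  have "AE t in lebesgue_on I. RL_integral \<alpha> t0 ?f t + RL_integral \<alpha> t0 ?g t = RL_integral \<alpha> t0 (\<lambda>s. ?f s + ?g s) t"
    using RL_integral_add(2)[OF f(1) g(1)] by (intro AE_I2) simp
  then have "Bochner_measurable (lebesgue_on I) (RL_integral \<alpha> t0 (\<lambda>s. ?f s + ?g s))"
    by (rule Bochner_measurable_cong_AE) (rule Bochner_measurable_add[OF f(2) g(2)])
  then show ?case
    unfolding eq by (intro conjI ballI RL_integral_add(1) f(1) g(1))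
qed

text \<open>The function is decomposed into its level sets inside \<open>I\<close>. The
  decomposition holds on \<open>I\<close> only, so it is transferred by almost everywhere equality
  on \<open>I\<close>. The level set of the value 0 may have infinite measure, but its term is
  0.\<close>

lemma RL_integral_simple_measurable:
  fixes s :: "real \<Rightarrow> 'x::banach"
  assumes "simple_integrable (lebesgue_on I) s"
  shows "Bochner_measurable (lebesgue_on I) (RL_integral \<alpha> t0 s)"
proof -
  have s: "simple_function (lebesgue_on I) s"
    using assms by (rule Bochner_Integration.simple_bochner_integrable.cases) assumption
  define A where "A y = s -` {y} \<inter> I" for y
  have A: "A y \<in> sets (lebesgue_on I)" for y
    using simple_functionD(2)[OF s, of "{y}"] by (simp add: A_def space_restrict_space)
  have fin: "finite (s ` I)"
    using simple_functionD(1)[OF s] by (simp add: space_restrict_space)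
  have repr: "(\<Sum>y\<in>s ` I. indicator (A y) x *\<^sub>R y) = s x" if "x \<in> I" for x
  proof -
    have "(\<Sum>y\<in>s ` I. indicator (A y) x *\<^sub>R y) = (\<Sum>y\<in>s ` I. if y = s x then y else 0)"
      using that by (intro sum.cong) (auto simp: A_def indicator_def)
    then show ?thesis using that fin by (simp add: sum.delta)
  qed
  have "AE t in lebesgue_on I. RL_integral \<alpha> t0 (\<lambda>x. \<Sum>y\<in>s ` I. indicator (A y) x *\<^sub>R y) t = RL_integral \<alpha> t0 s t"
    by (intro AE_I2 RL_integral_cong_AE) (simp_all add: space_restrict_space repr)
  then show ?thesis
    by (rule Bochner_measurable_cong_AE) (rule RL_integral_step[OF fin A, THEN conjunct2])
qed

section \<open>Bounds in L^q on \<open>I\<close> and strong measurability for general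
  \<open>f\<close>\<close>

lemma nn_integral_norm_extension:
  assumes p: "0 < p"
  shows "(\<integral>\<^sup>+s. ennreal ((indicator I s * norm (f s)) powr p) \<partial>lborel)
    = (\<integral>\<^sup>+s. ennreal (norm (f s) powr p) \<partial>lebesgue_on I)"
proof -
  have "(\<integral>\<^sup>+s. ennreal (norm (f s) powr p) \<partial>lebesgue_on I)
      = (\<integral>\<^sup>+s. ennreal (norm (f s) powr p) * indicator I s \<partial>lborel)"
    using I_lebesgue by (simp add: nn_integral_restrict_space nn_integral_completion)
  also have "\<dots> = (\<integral>\<^sup>+s. ennreal ((indicator I s * norm (f s)) powr p) \<partial>lborel)"
    using p by (intro nn_integral_cong) (auto simp: indicator_def)
  finally show ?thesis by simp
qed

lemma majorant_Lq_bound: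
  fixes p q C :: real
  assumes p: "0 < p"
    and hls: "hls_bound \<alpha> p q C"
    and f: "Bochner_measurable (lebesgue_on I) f" and A: "0 \<le> A"
    and le: "(\<integral>\<^sup>+s. ennreal (norm (f s) powr p) \<partial>lebesgue_on I) \<le> ennreal (A powr p)"
  shows "AE t in lebesgue_on I. majorant f t < \<infinity>"
    and "(\<integral>\<^sup>+t. ennreal (enn2real (majorant f t) powr q) \<partial>lebesgue_on I) \<le> ennreal (C * A powr q)"
proof -
  have *: "AE t in lborel. majorant f t < \<infinity>"
    "(\<integral>\<^sup>+t. ennreal (enn2real (majorant f t) powr q) \<partial>lborel) \<le> ennreal (C * A powr q)"
    using hls[unfolded hls_bound_def, rule_format, of "\<lambda>s. indicator I s * norm (f s)" A]
      norm_extension_measurable[OF f] A le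
    by (simp_all add: nn_integral_norm_extension[OF p])
  from *(1) have "AE t in lebesgue. majorant f t < \<infinity>" by (rule AE_completion)
  then show "AE t in lebesgue_on I. majorant f t < \<infinity>"
    using I_lebesgue by (subst AE_restrict_space_iff) (auto elim!: eventually_mono)
  have "(\<integral>\<^sup>+t. ennreal (enn2real (majorant f t) powr q) \<partial>lebesgue_on I)
      = (\<integral>\<^sup>+t. ennreal (enn2real (majorant f t) powr q) * indicator I t \<partial>lborel)"
    using I_lebesgue by (simp add: nn_integral_restrict_space nn_integral_completion)
  also have "\<dots> \<le> (\<integral>\<^sup>+t. ennreal (enn2real (majorant f t) powr q) \<partial>lborel)"
    by (intro nn_integral_mono) (auto simp: indicator_def)
  also note *(2)
  finally show "(\<integral>\<^sup>+t. ennreal (enn2real (majorant f t) powr q) \<partial>lebesgue_on I) \<le> ennreal (C * A powr q)" .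
qed

lemma RL_integral_Lq_bound:
  fixes f :: "real \<Rightarrow> 'x::banach"
  assumes q: "0 < q" and f: "Bochner_measurable (lebesgue_on I) f"
    and fin: "AE t in lebesgue_on I. majorant f t < \<infinity>"
    and le: "(\<integral>\<^sup>+t. ennreal (enn2real (majorant f t) powr q) \<partial>lebesgue_on I) \<le> ennreal B"
  shows "(\<integral>\<^sup>+t. ennreal (norm (RL_integral \<alpha> t0 f t) powr q) \<partial>lebesgue_on I) \<le> ennreal (B / Gamma \<alpha> powr q)"
proof -
  note [measurable] = enn2real_majorant_measurable[OF f]
  have G: "0 < Gamma \<alpha>" by (rule Gamma_real_pos[OF \<alpha>])
  have "(\<integral>\<^sup>+t. ennreal (norm (RL_integral \<alpha> t0 f t) powr q) \<partial>lebesgue_on I)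
      \<le> (\<integral>\<^sup>+t. ennreal (inverse (Gamma \<alpha> powr q)) * ennreal (enn2real (majorant f t) powr q) \<partial>lebesgue_on I)"
  proof (rule nn_integral_mono_AE)
    show "AE t in lebesgue_on I. ennreal (norm (RL_integral \<alpha> t0 f t) powr q)
        \<le> ennreal (inverse (Gamma \<alpha> powr q)) * ennreal (enn2real (majorant f t) powr q)"
      using fin AE_space
    proof eventually_elim
      case (elim t)
      then have "norm (RL_integral \<alpha> t0 f t) powr q \<le> (enn2real (majorant f t) / Gamma \<alpha>) powr q"
        using q by (intro powr_mono2 norm_RL_integral_le) (auto simp: space_restrict_space)
      also have "\<dots> = inverse (Gamma \<alpha> powr q) * enn2real (majorant f t) powr q"
        using G by (simp add: powr_divide field_simps)
      finally show ?case by (simp add: ennreal_mult[symmetric] ennreal_leI)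
    qed
  qed
  also have "\<dots> = ennreal (inverse (Gamma \<alpha> powr q)) * (\<integral>\<^sup>+t. ennreal (enn2real (majorant f t) powr q) \<partial>lebesgue_on I)"
    by (rule nn_integral_cmult) measurable
  also have "\<dots> \<le> ennreal (inverse (Gamma \<alpha> powr q)) * ennreal B"
    by (intro mult_left_mono le) auto
  also have "\<dots> = ennreal (B / Gamma \<alpha> powr q)"
    by (subst ennreal_mult'[symmetric]) (simp_all add: divide_inverse mult.commute)
  finally show ?thesis .
qed

text \<open>
  Simple functions \<open>s n\<close> approximate \<open>f\<close> in \<open>L\<^sup>p\<close>, and simple functions \<open>h n\<close> approximate the
  fractional integral of \<open>s n\<close> in \<open>L\<^sup>q\<close>. Both errors are summable, so \<open>h n\<close> tends to the
  fractional integral of \<open>f\<close> almost everywhere.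
\<close>

lemma RL_integral_Bochner_measurable:
  fixes f :: "real \<Rightarrow> 'x::banach" and p q C :: real
  assumes p: "0 < p" and q: "0 < q" and C: "0 < C"
    and hls: "hls_bound \<alpha> p q C"
    and f: "Bochner_measurable (lebesgue_on I) f"
    and fin: "(\<integral>\<^sup>+s. ennreal (norm (f s) powr p) \<partial>lebesgue_on I) < \<infinity>"
  shows "Bochner_measurable (lebesgue_on I) (RL_integral \<alpha> t0 f)"
proof -
  note bound = majorant_Lq_bound[OF p hls]
  have maj_fin: "AE t in lebesgue_on I. majorant g t < \<infinity>" "\<exists>B. (\<integral>\<^sup>+t. ennreal (enn2real (majorant g t) powr q) \<partial>lebesgue_on I) \<le> ennreal B"
    if g: "Bochner_measurable (lebesgue_on I) g" "(\<integral>\<^sup>+s. ennreal (norm (g s) powr p) \<partial>lebesgue_on I) < \<infinity>"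
    for g :: "real \<Rightarrow> 'x"
  proof -
    obtain r where r: "0 \<le> r" "(\<integral>\<^sup>+s. ennreal (norm (g s) powr p) \<partial>lebesgue_on I) = ennreal r"
      using g(2) by (cases "\<integral>\<^sup>+s. ennreal (norm (g s) powr p) \<partial>lebesgue_on I") auto
    then have le: "(\<integral>\<^sup>+s. ennreal (norm (g s) powr p) \<partial>lebesgue_on I) \<le> ennreal ((r powr (1 / p)) powr p)"
      using p by (simp add: powr_powr)
    show "AE t in lebesgue_on I. majorant g t < \<infinity>"
      by (rule bound(1)[OF g(1) _ le]) simp
    show "\<exists>B. (\<integral>\<^sup>+t. ennreal (enn2real (majorant g t) powr q) \<partial>lebesgue_on I) \<le> ennreal B"
      by (rule exI, rule bound(2)[OF g(1) _ le]) simp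
  qed
  obtain s' where s': "\<And>i::nat. simple_integrable (lebesgue_on I) (s' i)"
    and s'_lim: "(\<lambda>i. \<integral>\<^sup>+x. ennreal (norm (f x - s' i x) powr p) \<partial>lebesgue_on I) \<longlonglongrightarrow> 0"
    by (rule M.simple_integrable_dense[OF f p fin]) blast
  \<comment> \<open>\<open>A n\<close> is the error allowed in L^p: the Hardy-Littlewood-Sobolev
    bound \<open>C * A n powr q\<close> then equals \<open>(1 / 2) ^ n\<close>.\<close>
  define A where "A n = ((1 / 2) ^ n / C) powr (1 / q)" for n :: nat
  have A: "0 < A n" "C * A n powr q = (1 / 2) ^ n" for n
    using C q by (auto simp: A_def powr_powr)
  have "\<forall>n. \<exists>s. simple_integrable (lebesgue_on I) s \<and>
      (\<integral>\<^sup>+x. ennreal (norm (f x - s x) powr p) \<partial>lebesgue_on I) \<le> ennreal (A n powr p)"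
  proof
    fix n
    have "\<forall>\<^sub>F i in sequentially. (\<integral>\<^sup>+x. ennreal (norm (f x - s' i x) powr p) \<partial>lebesgue_on I) < ennreal (A n powr p)"
      using A(1)[of n] by (intro order_tendstoD(2)[OF s'_lim]) simp
    then obtain i where "(\<integral>\<^sup>+x. ennreal (norm (f x - s' i x) powr p) \<partial>lebesgue_on I) < ennreal (A n powr p)"
      by (auto simp: eventually_sequentially)
    with s'[of i] show "\<exists>s. simple_integrable (lebesgue_on I) s \<and>
      (\<integral>\<^sup>+x. ennreal (norm (f x - s x) powr p) \<partial>lebesgue_on I) \<le> ennreal (A n powr p)"
      by (intro exI[of _ "s' i"]) auto
  qed
  from choice[OF this] obtain s where s: "\<And>n::nat. simple_integrable (lebesgue_on I) (s n)"
    and s_le: "\<And>n. (\<integral>\<^sup>+x. ennreal (norm (f x - s n x) powr p) \<partial>lebesgue_on I) \<le> ennreal (A n powr p)"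
    by blast
  have s_meas: "Bochner_measurable (lebesgue_on I) (s n)" for n
    by (rule Bochner_measurable_simple[OF s])
  have d_meas: "Bochner_measurable (lebesgue_on I) (\<lambda>x. f x - s n x)" for n
    by (rule Bochner_measurable_diff[OF f s_meas])
  have s_fin: "(\<integral>\<^sup>+x. ennreal (norm (s n x) powr p) \<partial>lebesgue_on I) < \<infinity>" for n
    by (rule simple_integrable_powr_finite[OF s p])
  define D where "D n t = enn2real (majorant (\<lambda>x. f x - s n x) t)" for n t
  have D_lim: "AE t in lebesgue_on I. (\<lambda>n. D n t) \<longlonglongrightarrow> 0"
  proof (rule AE_tendsto_zero_of_summable_powr[OF _ _ q])
    show "D n \<in> borel_measurable (lebesgue_on I)" for n
      unfolding D_def by (rule enn2real_majorant_measurable[OF d_meas])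
    show "(\<integral>\<^sup>+t. ennreal (D n t powr q) \<partial>lebesgue_on I) \<le> ennreal ((1 / 2) ^ n)" for n
      unfolding D_def A(2)[of n, symmetric]
      by (rule bound(2)[OF d_meas less_imp_le[OF A(1)] s_le])
  qed (simp add: D_def)
  have "\<forall>n. \<exists>h. simple_integrable (lebesgue_on I) h \<and>
      (\<integral>\<^sup>+x. ennreal (norm (RL_integral \<alpha> t0 (s n) x - h x) powr q) \<partial>lebesgue_on I) \<le> ennreal ((1 / 2) ^ n)"
  proof
    fix n :: nat
    obtain B where "(\<integral>\<^sup>+t. ennreal (enn2real (majorant (s n) t) powr q) \<partial>lebesgue_on I) \<le> ennreal B"
      using maj_fin(2)[OF s_meas s_fin] by blast
    from RL_integral_Lq_bound[OF q s_meas maj_fin(1)[OF s_meas s_fin] this]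
    have "(\<integral>\<^sup>+t. ennreal (norm (RL_integral \<alpha> t0 (s n) t) powr q) \<partial>lebesgue_on I) < \<infinity>"
      by (rule order_le_less_trans) simp
    from M.simple_integrable_dense[OF RL_integral_simple_measurable[OF s] q this]
    obtain h where h: "\<And>i::nat. simple_integrable (lebesgue_on I) (h i)"
      and lim: "(\<lambda>i. \<integral>\<^sup>+x. ennreal (norm (RL_integral \<alpha> t0 (s n) x - h i x) powr q) \<partial>lebesgue_on I) \<longlonglongrightarrow> 0"
      by blast
    have "\<forall>\<^sub>F i in sequentially. (\<integral>\<^sup>+x. ennreal (norm (RL_integral \<alpha> t0 (s n) x - h i x) powr q) \<partial>lebesgue_on I) < ennreal ((1 / 2) ^ n)"
      by (intro order_tendstoD(2)[OF lim]) simp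
    then obtain i where "(\<integral>\<^sup>+x. ennreal (norm (RL_integral \<alpha> t0 (s n) x - h i x) powr q) \<partial>lebesgue_on I) < ennreal ((1 / 2) ^ n)"
      by (auto simp: eventually_sequentially)
    with h[of i] show "\<exists>h. simple_integrable (lebesgue_on I) h \<and>
      (\<integral>\<^sup>+x. ennreal (norm (RL_integral \<alpha> t0 (s n) x - h x) powr q) \<partial>lebesgue_on I) \<le> ennreal ((1 / 2) ^ n)"
      by (intro exI[of _ "h i"]) auto
  qed
  from choice[OF this] obtain h where h: "\<And>n::nat. simple_integrable (lebesgue_on I) (h n)"
    and h_le: "\<And>n. (\<integral>\<^sup>+x. ennreal (norm (RL_integral \<alpha> t0 (s n) x - h n x) powr q) \<partial>lebesgue_on I) \<le> ennreal ((1 / 2) ^ n)"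
    by blast
  have h_lim: "AE t in lebesgue_on I. (\<lambda>n. norm (RL_integral \<alpha> t0 (s n) t - h n t)) \<longlonglongrightarrow> 0"
    by (rule AE_tendsto_zero_of_summable_powr[OF _ _ q h_le])
      (rule M.Bochner_measurable_diff_norm[OF RL_integral_simple_measurable[OF s] h], rule norm_ge_zero)
  \<comment> \<open>Countably many exceptional null sets are merged, so that one point
    \<open>t\<close> serves all \<open>n\<close> at once.\<close>
  have D_fin: "AE t in lebesgue_on I. \<forall>n. majorant (\<lambda>x. f x - s n x) t < \<infinity>"
    unfolding AE_all_countable
  proof
    fix n show "AE t in lebesgue_on I. majorant (\<lambda>x. f x - s n x) t < \<infinity>"
      by (rule bound(1)[OF d_meas less_imp_le[OF A(1)] s_le])
  qed
  have s_maj: "AE t in lebesgue_on I. \<forall>n. majorant (s n) t < \<infinity>"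
    unfolding AE_all_countable by (intro allI maj_fin(1)[OF s_meas s_fin])
  have "AE t in lebesgue_on I. (\<lambda>n. h n t) \<longlonglongrightarrow> RL_integral \<alpha> t0 f t"
    using D_fin s_maj D_lim h_lim AE_space
  proof eventually_elim
    case (elim t)
    then have t: "t \<in> I" by (simp add: space_restrict_space)
    have "norm (h n t - RL_integral \<alpha> t0 f t) \<le> D n t / Gamma \<alpha> + norm (RL_integral \<alpha> t0 (s n) t - h n t)" for n
    proof -
      have "RL_exists_at \<alpha> t0 (\<lambda>x. f x - s n x) t" "RL_exists_at \<alpha> t0 (s n) t"
        using elim(1,2) by (intro RL_exists_atI t d_meas s_meas; blast)+
      from RL_integral_add(2)[OF this]
      \<comment> \<open>\<open>f\<close> is split as \<open>(f - s n) + s n\<close>. Finite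
        majorants give existence of both integrals at \<open>t\<close>, so additivity applies and
        the error of \<open>h n\<close> separates into the two controlled parts.\<close>
      have eq: "RL_integral \<alpha> t0 f t = RL_integral \<alpha> t0 (\<lambda>x. f x - s n x) t + RL_integral \<alpha> t0 (s n) t"
        by simp
      have "norm (h n t - RL_integral \<alpha> t0 f t)
        \<le> norm (RL_integral \<alpha> t0 (\<lambda>x. f x - s n x) t) + norm (RL_integral \<alpha> t0 (s n) t - h n t)"
        using norm_triangle_ineq4[of "h n t - RL_integral \<alpha> t0 (s n) t" "RL_integral \<alpha> t0 (\<lambda>x. f x - s n x) t"]
        unfolding eq by (simp add: norm_minus_commute[of "h n t"] algebra_simps)
      also have "norm (RL_integral \<alpha> t0 (\<lambda>x. f x - s n x) t) \<le> D n t / Gamma \<alpha>"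
        unfolding D_def using elim(1) by (intro norm_RL_integral_le t) blast
      finally show ?thesis by simp
    qed
    moreover have "(\<lambda>n. D n t / Gamma \<alpha> + norm (RL_integral \<alpha> t0 (s n) t - h n t)) \<longlonglongrightarrow> 0 / Gamma \<alpha> + 0"
      using elim(3,4) Gamma_real_pos[OF \<alpha>] by (intro tendsto_add tendsto_divide tendsto_const) simp_all
    ultimately have "(\<lambda>n. norm (h n t - RL_integral \<alpha> t0 f t)) \<longlonglongrightarrow> 0"
      by (intro tendsto_sandwich[OF _ _ tendsto_const, of 0 "\<lambda>n. norm (h n t - RL_integral \<alpha> t0 f t)"]) simp_all
    then show ?case by (rule LIM_zero_cancel[OF tendsto_norm_zero_cancel])
  qed
  then show ?thesis
    unfolding Bochner_measurable_def by (intro exI[of _ h] conjI allI h)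
qed

text \<open>For \<open>q \<ge> 1\<close> the norm is at most 1 plus its power \<open>q\<close>, and
  the constant 1 is integrable because \<open>{t0..T}\<close> has finite measure.\<close>

lemma Lp_imp_Bochner_integrable_subinterval:
  fixes g :: "real \<Rightarrow> 'x::banach"
  assumes g: "g \<in> Lp (lebesgue_on I) q" and q: "1 \<le> q" and T: "{t0..T} \<subseteq> I"
  shows "Bochner_integrable (lebesgue_on {t0..T}) g"
proof (rule complete_measure.Bochner_integrableI_bounded)
  show "complete_measure (lebesgue_on {t0..T})"
    by (rule complete_measure_lebesgue_on) simp
  have g_meas: "Bochner_measurable (lebesgue_on I) g"
    and g_int: "integrable (lebesgue_on I) (\<lambda>x. norm (g x) powr q)"
    using g by (auto simp: Lp_def)
  show meas: "Bochner_measurable (lebesgue_on {t0..T}) g"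
    by (rule Bochner_measurable_subinterval[OF T g_meas])
  have [measurable]: "(\<lambda>x. norm (g x)) \<in> borel_measurable (lebesgue_on {t0..T})"
    by (intro complete_measure.Bochner_measurable_norm complete_measure_lebesgue_on meas) simp
  have "(\<integral>\<^sup>+x. ennreal (norm (g x)) \<partial>lebesgue_on {t0..T})
      \<le> (\<integral>\<^sup>+x. 1 + ennreal (norm (g x) powr q) \<partial>lebesgue_on {t0..T})"
  proof (rule nn_integral_mono)
    fix x
    have "norm (g x) \<le> 1 + norm (g x) powr q"
    proof (cases "norm (g x) \<le> 1")
      case False
      then have "norm (g x) powr 1 \<le> norm (g x) powr q" using q by (intro powr_mono) auto
      then show ?thesis by simp
    qed (simp add: add_increasing2)
    then have "ennreal (norm (g x)) \<le> ennreal (1 + norm (g x) powr q)" by (rule ennreal_leI)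
    then show "ennreal (norm (g x)) \<le> 1 + ennreal (norm (g x) powr q)" by simp
  qed
  also have "\<dots> = emeasure (lebesgue_on {t0..T}) (space (lebesgue_on {t0..T}))
      + (\<integral>\<^sup>+x. ennreal (norm (g x) powr q) \<partial>lebesgue_on {t0..T})"
    by (subst nn_integral_add) auto
  also have "\<dots> < \<infinity>"
  proof -
    have "(\<integral>\<^sup>+x. ennreal (norm (g x) powr q) \<partial>lebesgue_on {t0..T}) \<le> (\<integral>\<^sup>+x. ennreal (norm (g x) powr q) \<partial>lebesgue_on I)"
      by (rule nn_integral_subinterval_le[OF T])
    also have "\<dots> < \<infinity>"
      using nn_integral_eq_integral[OF g_int] by simp
    finally show ?thesis
      by (simp add: space_restrict_space emeasure_restrict_space emeasure_lborel_Icc_eq)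
  qed
  finally show "(\<integral>\<^sup>+x. ennreal (norm (g x)) \<partial>lebesgue_on {t0..T}) < \<infinity>" .
qed

end

section \<open>Boundedness from L^p into L^q, uniformly in the interval\<close>

theorem theorem18:
  fixes p \<alpha> :: real
  assumes "1 < p" and "0 < \<alpha>" and "\<alpha> < 1 / p"
  shows "\<exists>C>0. \<forall>(t0::real) (I::real set).
    (\<exists>t1\<ge>t0. I = {t0..t1}) \<or> I = {t0..} \<longrightarrow>
      (\<forall>f :: real \<Rightarrow> 'x::banach. f \<in> Lp (lebesgue_on I) p \<longrightarrow>
         (AE t in lebesgue_on I. RL_exists_at \<alpha> t0 f t) \<and>
         (\<forall>T. {t0..T} \<subseteq> I \<longrightarrow> Bochner_integrable (lebesgue_on {t0..T}) (RL_integral \<alpha> t0 f)) \<and>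
         RL_integral \<alpha> t0 f \<in> Lp (lebesgue_on I) (p / (1 - p * \<alpha>)) \<and>
         (LINT s|lebesgue_on I. norm (RL_integral \<alpha> t0 f s) powr (p / (1 - p * \<alpha>)))
             powr ((1 - p * \<alpha>) / p)
           \<le> C * (LINT s|lebesgue_on I. norm (f s) powr p) powr (1 / p)) \<and>
      Lp_bounded_operator (lebesgue_on I) p (p / (1 - p * \<alpha>))
        (RL_integral \<alpha> t0 :: (real \<Rightarrow> 'x) \<Rightarrow> real \<Rightarrow> 'x)"
proof -
  define q where "q = p / (1 - p * \<alpha>)"
  have p: "0 < p" and \<alpha>: "0 < \<alpha>" using assms by auto
  have pa: "p * \<alpha> < 1" using assms by (simp add: field_simps)
  \<comment> \<open>Gives 1 - p \<alpha> < 1 < p, hence \<open>q \<ge> 1\<close>, which local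
    integrability of the fractional integral relies on.\<close>
  have "0 < p * \<alpha>" using p \<alpha> by simp
  then have "1 - p * \<alpha> \<le> p" using assms(1) by linarith
  then have q: "1 \<le> q" using pa by (simp add: q_def)
  then have q0: "0 < q" by simp
  have q_inv: "(1 - p * \<alpha>) / p = 1 / q" by (simp add: q_def)
  have G: "0 < Gamma \<alpha>" by (rule Gamma_real_pos[OF \<alpha>])
  obtain C where C: "0 < C"
    and hls: "hls_bound \<alpha> p q C"
    unfolding q_def by (rule hardy_littlewood_sobolev[OF assms])
  \<comment> \<open>\<open>C\<close> bounds the power \<open>q\<close> of the norm of the
    convolution without the Gamma factor. \<open>K\<close> is its root of order \<open>q\<close>,
    divided by \<open>Gamma \<alpha>\<close>, and is fixed before \<open>t0\<close> and
    \<open>I\<close>.\<close>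
  define K where "K = C powr (1 / q) / Gamma \<alpha>"
  have K: "0 < K" using C G by (simp add: K_def)
  have main: "(AE t in lebesgue_on I. RL_exists_at \<alpha> t0 f t) \<and>
         (\<forall>T. {t0..T} \<subseteq> I \<longrightarrow> Bochner_integrable (lebesgue_on {t0..T}) (RL_integral \<alpha> t0 f)) \<and>
         RL_integral \<alpha> t0 f \<in> Lp (lebesgue_on I) q \<and>
         (LINT s|lebesgue_on I. norm (RL_integral \<alpha> t0 f s) powr q) powr (1 / q)
           \<le> K * (LINT s|lebesgue_on I. norm (f s) powr p) powr (1 / p)"
    if I: "(\<exists>t1\<ge>t0. I = {t0..t1}) \<or> I = {t0..}" and f: "f \<in> Lp (lebesgue_on I) p"
    for t0 and I :: "real set" and f :: "real \<Rightarrow> 'x"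
  proof -
    interpret RL_interval \<alpha> t0 I by standard (use \<alpha> I in auto)
    have f_meas: "Bochner_measurable (lebesgue_on I) f"
      and f_int: "integrable (lebesgue_on I) (\<lambda>x. norm (f x) powr p)"
      using f by (auto simp: Lp_def)
    define A where "A = (LINT s|lebesgue_on I. norm (f s) powr p) powr (1 / p)"
    have "(\<integral>\<^sup>+s. ennreal (norm (f s) powr p) \<partial>lebesgue_on I) = ennreal (LINT s|lebesgue_on I. norm (f s) powr p)"
      by (rule nn_integral_eq_integral[OF f_int]) simp
    also have "\<dots> = ennreal (A powr p)" using p by (simp add: A_def powr_powr)
    finally have f_nn: "(\<integral>\<^sup>+s. ennreal (norm (f s) powr p) \<partial>lebesgue_on I) = ennreal (A powr p)" .
    have A: "0 \<le> A" by (simp add: A_def)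
    have fin: "AE t in lebesgue_on I. majorant f t < \<infinity>"
      and maj: "(\<integral>\<^sup>+t. ennreal (enn2real (majorant f t) powr q) \<partial>lebesgue_on I) \<le> ennreal (C * A powr q)"
      using majorant_Lq_bound[OF p hls f_meas A eq_refl[OF f_nn]] by blast+
    have ex: "AE t in lebesgue_on I. RL_exists_at \<alpha> t0 f t"
      using fin AE_space
      by eventually_elim (rule RL_exists_atI[OF _ f_meas], simp_all add: space_restrict_space)
    have R_meas: "Bochner_measurable (lebesgue_on I) (RL_integral \<alpha> t0 f)"
      by (rule RL_integral_Bochner_measurable[OF p q0 C hls f_meas]) (simp add: f_nn)
    have R_le: "(\<integral>\<^sup>+t. ennreal (norm (RL_integral \<alpha> t0 f t) powr q) \<partial>lebesgue_on I)
        \<le> ennreal (C * A powr q / Gamma \<alpha> powr q)"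
      by (rule RL_integral_Lq_bound[OF q0 f_meas fin maj])
    have [measurable]: "(\<lambda>t. norm (RL_integral \<alpha> t0 f t)) \<in> borel_measurable (lebesgue_on I)"
      by (rule M.Bochner_measurable_norm[OF R_meas])
    have R_int: "integrable (lebesgue_on I) (\<lambda>t. norm (RL_integral \<alpha> t0 f t) powr q)"
      using order_le_less_trans[OF R_le ennreal_less_top] by (intro integrableI_bounded) simp_all
    then have R_Lp: "RL_integral \<alpha> t0 f \<in> Lp (lebesgue_on I) q"
      using R_meas by (simp add: Lp_def)
    have "ennreal (LINT s|lebesgue_on I. norm (RL_integral \<alpha> t0 f s) powr q) \<le> ennreal (C * A powr q / Gamma \<alpha> powr q)"
      using R_le by (subst nn_integral_eq_integral[OF R_int, symmetric]) auto
    then have "(LINT s|lebesgue_on I. norm (RL_integral \<alpha> t0 f s) powr q) \<le> C * A powr q / Gamma \<alpha> powr q"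
      using C by (subst (asm) ennreal_le_iff) auto
    then have "(LINT s|lebesgue_on I. norm (RL_integral \<alpha> t0 f s) powr q) powr (1 / q)
        \<le> (C * A powr q / Gamma \<alpha> powr q) powr (1 / q)"
      using q0 by (intro powr_mono2) auto
    also have "\<dots> = K * A"
      using C A G q0 by (simp add: K_def powr_mult powr_divide powr_powr)
    finally show ?thesis
      unfolding A_def
      by (intro conjI ex R_Lp allI impI Lp_imp_Bochner_integrable_subinterval[OF R_Lp q])
  qed
  have operator: "Lp_bounded_operator (lebesgue_on I) p q (RL_integral \<alpha> t0 :: (real \<Rightarrow> 'x) \<Rightarrow> real \<Rightarrow> 'x)"
    if I: "(\<exists>t1\<ge>t0. I = {t0..t1}) \<or> I = {t0..}" for t0 and I :: "real set"
    unfolding Lp_bounded_operator_def Lp_norm_def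
  proof (intro conjI ballI allI impI exI[of _ K])
    interpret RL_interval \<alpha> t0 I by standard (use \<alpha> I in auto)
    fix f :: "real \<Rightarrow> 'x" assume f: "f \<in> Lp (lebesgue_on I) p"
    show "RL_integral \<alpha> t0 f \<in> Lp (lebesgue_on I) q"
      "(LINT s|lebesgue_on I. norm (RL_integral \<alpha> t0 f s) powr q) powr (1 / q)
           \<le> K * (LINT s|lebesgue_on I. norm (f s) powr p) powr (1 / p)"
      using main[OF I f] by auto
    \<comment> \<open>Linearity is proved at points where the integrals exist, hence almost
      everywhere. Elsewhere the default value 0 could break additivity, as a sum may be integrable
      when its summands are not.\<close>
    have f_ex: "AE t in lebesgue_on I. RL_exists_at \<alpha> t0 f t" using main[OF I f] by blast
    show "AE x in lebesgue_on I. RL_integral \<alpha> t0 (\<lambda>y. c *\<^sub>R f y) x = c *\<^sub>R RL_integral \<alpha> t0 f x" for c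
      using f_ex by eventually_elim (rule RL_integral_scaleR(2))
    fix g :: "real \<Rightarrow> 'x" assume g: "g \<in> Lp (lebesgue_on I) p"
    have g_ex: "AE t in lebesgue_on I. RL_exists_at \<alpha> t0 g t" using main[OF I g] by blast
    show "AE x in lebesgue_on I. RL_integral \<alpha> t0 (\<lambda>y. f y + g y) x = RL_integral \<alpha> t0 f x + RL_integral \<alpha> t0 g x"
      using f_ex g_ex by eventually_elim (rule RL_integral_add(2))
    assume eq: "AE x in lebesgue_on I. f x = g x"
    show "AE x in lebesgue_on I. RL_integral \<alpha> t0 f x = RL_integral \<alpha> t0 g x"
      by (intro AE_I2 RL_integral_cong_AE[OF _ eq]) (simp add: space_restrict_space)
  qed
  show ?thesis
    unfolding q_def[symmetric] q_inv
    by (rule exI[of _ K], rule conjI[OF K], intro allI impI, rule conjI[OF _ operator])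
      (intro allI impI, rule main)
qed

end
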